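(* Let $(z,\alpha)$ be an S-pair and let $p\in K\setminus\alpha$ be an index such that $$n_p^TH_\alpha n_p\ge0\quad\text{and}\quad s_p(z)>0 .$$ Then the step procedure described in the context, started from $(z,\alpha)$ and $p$ (with step directions $d=H_\alpha n_p$ for the current active set), either produces a new S-pair $(\bar z,\bar\alpha\cup\{p\})$ with $\bar\alpha\subseteq\alpha$ and $f(\bar z)<f(z)$ after $|\alpha|-|\bar\alpha|$ partial steps and one full step, or, within at most $|\alpha|$ steps, it stops (with $t=\infty$) at a current active set $\bar\alpha\subseteq\alpha$ for which $P(\bar\alpha\cup\{p\})$ is infeasible, i.e. admits no local minimax point.
   Context: **Setting.** $f(z)=\tfrac12z^TGz+c^Tz$, $z=(x,y)\in\mathbb{R}^{n_x}\times\mathbb{R}^{n_y}$, $G=\begin{bmatrix} G_{11} & G_{12} \\ G_{12}^T & G_{22} \end{bmatrix}$ symmetric with $G_{22}$ negative definite; constraints $s(z)=Dz+h\le0$ with $D=[A\ \ B]$, $A\in\mathbb{R}^{m\times n_x}$, $B\in\mathbb{R}^{m\times n_y}$, $h\in\mathbb{R}^m$, $[m]=\{1,\dots,m\}$. Standing assumption: $G_{11}-G_{12}G_{22}^{-1}G_{12}^T\succ0$ (so $G$ is invertible). Write $g(z)=Gz+c$, $n_i=D_i^T$, $s_i(z)=n_i^Tz+h_i$, $N_\alpha=D_\alpha^T$ for $\alpha\subseteq[m]$, and $K=\{i\in[m]: n_i^TG^{-1}n_i<0\}$. **Operators.** $N_\alpha^*=(N_\alpha^TG^{-1}N_\alpha)^{-1}N_\alpha^TG^{-1}$,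 $H_\alpha=G^{-1}-G^{-1}N_\alpha(N_\alpha^TG^{-1}N_\alpha)^{-1}N_\alpha^TG^{-1}$ (with $H_\emptyset=G^{-1}$). Also $$\Gamma_\alpha=G_{11}-\begin{bmatrix} G_{12} & A_\alpha^T \end{bmatrix}\begin{bmatrix} G_{22} & B_\alpha^T \\ B_\alpha & 0 \end{bmatrix}^{-1}\begin{bmatrix} G_{12}^T \\ A_\alpha \end{bmatrix}$$ (writing $\Gamma_\alpha$ presupposes that the rows of $B_\alpha$ are linearly independent). **Local minimax point.** For $J\subseteq[m]$, $P(J)$ is the problem $\min_x\max_y f(z)$ s.t. $D_Jz+h_J\le0$. With $Y_J(x)=\{y: D_J(x,y)+h_J\le0\}$, a point $(x^*,y^* )$ with $y^*\in Y_J(x^* )$ is a local minimax point of $P(J)$ if there are $\delta_0>0$ and $\eta:(0,\delta_0]\to\mathbb{R}_+$ with $\eta(\delta)\to0$ as $\delta\to0$ such that for all $\delta\in(0,\delta_0]$, $x\in\mathbb{B}_\delta(x^* )$, $y\in Y_J(x^* )\cap\mathbb{B}_\delta(y^* )$: $f(x^*,y)\le f(x^*,y^* )\le\max\{f(x,\omega):\omega\in Y_J(x)\cap\mathbb{B}_{\eta(\delta)}(y^* )\}$. **S-pair.** $(z,\alpha)$ is an S-pair if $z$ is a local minimax point of $P(\alpha)$, $s_i(z)=0$ for all $i\in\alpha$, there are $\lambda_i\le0$ ($i\in\alpha$) with $Gz+c+\sum_{i\in\alpha}\lambda_in_i=0$, $\Gamma_\alpha\succ0$, and $\{D_i:i\in\alpha\}$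 is linearly independent. Its multiplier vector is $u=-N_\alpha^*g(z)=(\lambda_i)_{i\in\alpha}\le0$. **Step procedure** from an S-pair $(z,\alpha)$ and index $p$. Put $n^+=n_p$, $u^+=(u,0)$ (entries indexed by $\alpha$ and then $p$). Repeat: compute $d=H_\alpha n^+$, $r=-N_\alpha^*n^+$; let $t_1=\min\{u_j^+/r_j: j\in\alpha,\ r_j<0\}$ ($=\infty$ if there is no such $j$), attained at $j=k$; let $t_2=\infty$ if $d^Tn^+\ge0$ and $t_2=-s_p(z)/(d^Tn^+)$ otherwise; $t=\min\{t_1,t_2\}$. If $t=\infty$, stop. Otherwise set $z\leftarrow z+td$, $u^+\leftarrow u^+-t\,(r,1)$. If $t=t_2$, this is a *full step*: set $\alpha\leftarrow\alpha\cup\{p\}$ and stop with the pair $(z,\alpha)$. Otherwise it is a *partial step*: set $\alpha\leftarrow\alpha\setminus\{k\}$, delete the $k$-th entry of $u^+$, and repeat. *)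

theory Defs
  imports "HOL-Analysis.Analysis"
begin

text \<open>
  A point \<open>z = (x, y)\<close> is one vector over the sum index type \<open>'x + 'y\<close>. Matrices and vectors
  indexed by a set \<open>\<alpha>\<close> of constraints are kept over the full constraint type \<open>'m\<close>, with all entries
  outside \<open>\<alpha>\<close> equal to zero; products of such zero-padded matrices are the padded products.
\<close>

definition join :: "real^'x \<Rightarrow> real^'y \<Rightarrow> real^('x::finite + 'y::finite)" where
  "join x y = (\<chi> k. case k of Inl a \<Rightarrow> x $ a | Inr b \<Rightarrow> y $ b)"

definition xpart :: "real^('x::finite + 'y::finite) \<Rightarrow> real^'x" where
  "xpart z = (\<chi> a. z $ Inl a)"

definition ypart :: "real^('x::finite + 'y::finite) \<Rightarrow> real^'y" where
  "ypart z = (\<chi> b. z $ Inr b)"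

definition blk11 :: "real^('x::finite + 'y::finite)^('x + 'y) \<Rightarrow> real^'x^'x" where
  "blk11 G = (\<chi> i j. G $ Inl i $ Inl j)"

definition blk12 :: "real^('x::finite + 'y::finite)^('x + 'y) \<Rightarrow> real^'y^'x" where
  "blk12 G = (\<chi> i j. G $ Inl i $ Inr j)"

definition blk22 :: "real^('x::finite + 'y::finite)^('x + 'y) \<Rightarrow> real^'y^'y" where
  "blk22 G = (\<chi> i j. G $ Inr i $ Inr j)"

definition Apart :: "real^('x::finite + 'y::finite)^'m \<Rightarrow> real^'x^'m" where
  "Apart D = (\<chi> i j. D $ i $ Inl j)"

definition Bpart :: "real^('x::finite + 'y::finite)^'m \<Rightarrow> real^'y^'m" where
  "Bpart D = (\<chi> i j. D $ i $ Inr j)"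

definition hcat :: "real^'a^'r \<Rightarrow> real^'b^'r \<Rightarrow> real^('a::finite + 'b::finite)^'r" where
  "hcat P Q = (\<chi> i k. case k of Inl a \<Rightarrow> P $ i $ a | Inr b \<Rightarrow> Q $ i $ b)"

definition vcat :: "real^'c^'a \<Rightarrow> real^'c^'b \<Rightarrow> real^'c^('a::finite + 'b::finite)" where
  "vcat P Q = (\<chi> k. case k of Inl a \<Rightarrow> P $ a | Inr b \<Rightarrow> Q $ b)"

definition posdef :: "real^'a^'a \<Rightarrow> bool" where
  "posdef M \<longleftrightarrow> transpose M = M \<and> (\<forall>v. v \<noteq> 0 \<longrightarrow> 0 < v \<bullet> (M *v v))"

definition rows_on :: "'m set \<Rightarrow> real^'a^'m \<Rightarrow> real^'a^'m" where
  "rows_on \<alpha> M = (\<chi> i j. if i \<in> \<alpha> then M $ i $ j else 0)"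

text \<open>Linear independence of the indexed family of rows, so repeated rows are excluded.\<close>

definition indep_rows :: "'m set \<Rightarrow> real^'a^'m \<Rightarrow> bool" where
  "indep_rows \<alpha> M \<longleftrightarrow> inj_on (\<lambda>i. row i M) \<alpha> \<and> independent ((\<lambda>i. row i M) ` \<alpha>)"

text \<open>The inverse of the submatrix with row and column indices in \<open>I\<close>, padded with zeros.
  As for \<^const>\<open>matrix_inv\<close>, the value is arbitrary when that submatrix is singular.\<close>

definition inv_on :: "'i::finite set \<Rightarrow> real^'i^'i \<Rightarrow> real^'i^'i" where
  "inv_on I M = (SOME X.
     (\<forall>i j. i \<notin> I \<or> j \<notin> I \<longrightarrow> X $ i $ j = 0) \<and>
     (\<forall>i\<in>I. \<forall>j\<in>I. (\<Sum>k\<in>I. M $ i $ k * X $ k $ j) = (if i = j then 1 else 0) \<and>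
                  (\<Sum>k\<in>I. X $ i $ k * M $ k $ j) = (if i = j then 1 else 0)))"

definition objective :: "real^('x::finite + 'y::finite)^('x + 'y) \<Rightarrow> real^('x + 'y) \<Rightarrow> real^('x + 'y) \<Rightarrow> real"
  where "objective G c z = (1/2) * (z \<bullet> (G *v z)) + c \<bullet> z"

definition grad :: "real^('x::finite + 'y::finite)^('x + 'y) \<Rightarrow> real^('x + 'y) \<Rightarrow> real^('x + 'y) \<Rightarrow> real^('x + 'y)"
  where "grad G c z = G *v z + c"

definition slack :: "real^('x::finite + 'y::finite)^'m \<Rightarrow> real^'m \<Rightarrow> 'm \<Rightarrow> real^('x + 'y) \<Rightarrow> real"
  where "slack D h i z = row i D \<bullet> z + h $ i"

definition Kset :: "real^('x::finite + 'y::finite)^('x + 'y) \<Rightarrow> real^('x + 'y)^'m \<Rightarrow> 'm set" where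
  "Kset G D = {i. row i D \<bullet> (matrix_inv G *v row i D) < 0}"

definition Nmat :: "real^('x::finite + 'y::finite)^'m \<Rightarrow> 'm set \<Rightarrow> real^'m^('x + 'y)" where
  "Nmat D \<alpha> = transpose (rows_on \<alpha> D)"

definition Nstar :: "real^('x::finite + 'y::finite)^('x + 'y) \<Rightarrow> real^('x + 'y)^'m::finite \<Rightarrow> 'm set
    \<Rightarrow> real^('x + 'y)^'m" where
  "Nstar G D \<alpha> =
     inv_on \<alpha> (transpose (Nmat D \<alpha>) ** matrix_inv G ** Nmat D \<alpha>)
       ** transpose (Nmat D \<alpha>) ** matrix_inv G"

definition Hmat :: "real^('x::finite + 'y::finite)^('x + 'y) \<Rightarrow> real^('x + 'y)^'m::finite \<Rightarrow> 'm set
    \<Rightarrow> real^('x + 'y)^('x + 'y)" where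
  "Hmat G D \<alpha> =
     matrix_inv G
     - matrix_inv G ** Nmat D \<alpha>
         ** inv_on \<alpha> (transpose (Nmat D \<alpha>) ** matrix_inv G ** Nmat D \<alpha>)
         ** transpose (Nmat D \<alpha>) ** matrix_inv G"

definition Gamma_mat :: "real^('x::finite + 'y::finite)^('x + 'y) \<Rightarrow> real^('x + 'y)^'m::finite \<Rightarrow> 'm set
    \<Rightarrow> real^'x^'x" where
  "Gamma_mat G D \<alpha> =
     (let A\<alpha> = rows_on \<alpha> (Apart D); B\<alpha> = rows_on \<alpha> (Bpart D) in
      blk11 G
      - hcat (blk12 G) (transpose A\<alpha>)
          ** inv_on (UNIV <+> \<alpha>) (vcat (hcat (blk22 G) (transpose B\<alpha>)) (hcat B\<alpha> 0))
          ** vcat (transpose (blk12 G)) A\<alpha>)"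

definition Yset :: "real^('x::finite + 'y::finite)^'m \<Rightarrow> real^'m \<Rightarrow> 'm set \<Rightarrow> real^'x \<Rightarrow> (real^'y) set" where
  "Yset D h J x = {y. \<forall>i\<in>J. slack D h i (join x y) \<le> 0}"

text \<open>
  The last conjunct says that \<open>max {f(x, \<omega>) | \<omega> \<in> Y\<^sub>J(x), |\<omega> - y\<^sup>*| \<le> \<eta>(\<delta>)}\<close> exists and is
  at least \<open>f(x\<^sup>*, y\<^sup>*)\<close>. The maximum is over a compact set, so it exists unless that set is empty;
  a point with an empty set there is not a local minimax point (the maximum is then \<open>-\<infinity>\<close>).
\<close>

definition local_minimax :: "real^('x::finite + 'y::finite)^('x + 'y) \<Rightarrow> real^('x + 'y)
    \<Rightarrow> real^('x + 'y)^'m \<Rightarrow> real^'m \<Rightarrow> 'm set \<Rightarrow> real^('x + 'y) \<Rightarrow> bool" where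
  "local_minimax G c D h J z \<longleftrightarrow>
     ypart z \<in> Yset D h J (xpart z) \<and>
     (\<exists>\<delta>0>0. \<exists>\<eta>::real \<Rightarrow> real.
        (\<forall>\<delta>\<in>{0<..\<delta>0}. 0 \<le> \<eta> \<delta>) \<and> (\<eta> \<longlongrightarrow> 0) (at_right 0) \<and>
        (\<forall>\<delta>\<in>{0<..\<delta>0}. \<forall>x\<in>cball (xpart z) \<delta>. \<forall>y\<in>Yset D h J (xpart z) \<inter> cball (ypart z) \<delta>.
           objective G c (join (xpart z) y) \<le> objective G c z \<and>
           (\<exists>v. v \<in> (\<lambda>\<omega>. objective G c (join x \<omega>)) ` (Yset D h J x \<inter> cball (ypart z) (\<eta> \<delta>)) \<and>
                (\<forall>w\<in>(\<lambda>\<omega>. objective G c (join x \<omega>)) ` (Yset D h J x \<inter> cball (ypart z) (\<eta> \<delta>)). w \<le> v) \<and>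
                objective G c z \<le> v)))"

definition S_pair :: "real^('x::finite + 'y::finite)^('x + 'y) \<Rightarrow> real^('x + 'y)
    \<Rightarrow> real^('x + 'y)^'m::finite \<Rightarrow> real^'m \<Rightarrow> real^('x + 'y) \<Rightarrow> 'm set \<Rightarrow> bool" where
  "S_pair G c D h z \<alpha> \<longleftrightarrow>
     local_minimax G c D h \<alpha> z \<and>
     (\<forall>i\<in>\<alpha>. slack D h i z = 0) \<and>
     (\<exists>l. (\<forall>i\<in>\<alpha>. l i \<le> 0) \<and> G *v z + c + (\<Sum>i\<in>\<alpha>. l i *\<^sub>R row i D) = 0) \<and>
     indep_rows \<alpha> (Bpart D) \<and> posdef (Gamma_mat G D \<alpha>) \<and>
     indep_rows \<alpha> D"

definition multipliers :: "real^('x::finite + 'y::finite)^('x + 'y) \<Rightarrow> real^('x + 'y)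
    \<Rightarrow> real^('x + 'y)^'m::finite \<Rightarrow> real^('x + 'y) \<Rightarrow> 'm set \<Rightarrow> real^'m" where
  "multipliers G c D z \<alpha> = - (Nstar G D \<alpha> *v grad G c z)"

text \<open>
  A state of the step procedure is \<open>(z, \<alpha>, u\<^sup>+)\<close>. The vector \<open>u\<^sup>+\<close>, whose entries are indexed by
  \<open>\<alpha>\<close> and \<open>p \<notin> \<alpha>\<close>, is zero-padded as above; in particular \<open>(u, 0)\<close> is \<open>u\<close> itself, and
  \<open>(r, 1)\<close> is \<open>r + axis p 1\<close>.
\<close>

type_synonym ('x, 'y, 'm) state = "(real^('x + 'y)) \<times> 'm set \<times> (real^'m)"

definition step_d :: "real^('x::finite + 'y::finite)^('x + 'y) \<Rightarrow> real^('x + 'y)^'m::finite \<Rightarrow> 'm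
    \<Rightarrow> 'm set \<Rightarrow> real^('x + 'y)" where
  "step_d G D p \<alpha> = Hmat G D \<alpha> *v row p D"

definition step_r :: "real^('x::finite + 'y::finite)^('x + 'y) \<Rightarrow> real^('x + 'y)^'m::finite \<Rightarrow> 'm
    \<Rightarrow> 'm set \<Rightarrow> real^'m" where
  "step_r G D p \<alpha> = - (Nstar G D \<alpha> *v row p D)"

text \<open>An infimum in \<^typ>\<open>ereal\<close>, so it is \<open>\<infinity>\<close> when no index qualifies.\<close>

fun step_t1 :: "real^('x::finite + 'y::finite)^('x + 'y) \<Rightarrow> real^('x + 'y)^'m::finite \<Rightarrow> 'm
    \<Rightarrow> ('x, 'y, 'm) state \<Rightarrow> ereal" where
  "step_t1 G D p (z, \<alpha>, u) =
     (INF j\<in>{j\<in>\<alpha>. step_r G D p \<alpha> $ j < 0}. ereal (u $ j / step_r G D p \<alpha> $ j))"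

fun t1_attaining :: "real^('x::finite + 'y::finite)^('x + 'y) \<Rightarrow> real^('x + 'y)^'m::finite \<Rightarrow> 'm
    \<Rightarrow> ('x, 'y, 'm) state \<Rightarrow> 'm set" where
  "t1_attaining G D p (z, \<alpha>, u) =
     {j\<in>\<alpha>. step_r G D p \<alpha> $ j < 0 \<and>
           ereal (u $ j / step_r G D p \<alpha> $ j) = step_t1 G D p (z, \<alpha>, u)}"

fun step_t2 :: "real^('x::finite + 'y::finite)^('x + 'y) \<Rightarrow> real^('x + 'y)^'m::finite \<Rightarrow> real^'m \<Rightarrow> 'm
    \<Rightarrow> ('x, 'y, 'm) state \<Rightarrow> ereal" where
  "step_t2 G D h p (z, \<alpha>, u) =
     (if step_d G D p \<alpha> \<bullet> row p D \<ge> 0 then \<infinity>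
      else ereal (- slack D h p z / (step_d G D p \<alpha> \<bullet> row p D)))"

definition step_t :: "real^('x::finite + 'y::finite)^('x + 'y) \<Rightarrow> real^('x + 'y)^'m::finite \<Rightarrow> real^'m \<Rightarrow> 'm
    \<Rightarrow> ('x, 'y, 'm) state \<Rightarrow> ereal" where
  "step_t G D h p S = min (step_t1 G D p S) (step_t2 G D h p S)"

text \<open>The update of \<open>z\<close> and \<open>u\<^sup>+\<close> common to both kinds of step.\<close>

fun step_z :: "real^('x::finite + 'y::finite)^('x + 'y) \<Rightarrow> real^('x + 'y)^'m::finite \<Rightarrow> real^'m \<Rightarrow> 'm
    \<Rightarrow> ('x, 'y, 'm) state \<Rightarrow> real^('x + 'y)" where
  "step_z G D h p (z, \<alpha>, u) =
     z + real_of_ereal (step_t G D h p (z, \<alpha>, u)) *\<^sub>R step_d G D p \<alpha>"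

fun step_u :: "real^('x::finite + 'y::finite)^('x + 'y) \<Rightarrow> real^('x + 'y)^'m::finite \<Rightarrow> real^'m \<Rightarrow> 'm
    \<Rightarrow> ('x, 'y, 'm) state \<Rightarrow> real^'m" where
  "step_u G D h p (z, \<alpha>, u) =
     u - real_of_ereal (step_t G D h p (z, \<alpha>, u)) *\<^sub>R (step_r G D p \<alpha> + axis p 1)"

definition stops_at :: "real^('x::finite + 'y::finite)^('x + 'y) \<Rightarrow> real^('x + 'y)^'m::finite \<Rightarrow> real^'m \<Rightarrow> 'm
    \<Rightarrow> ('x, 'y, 'm) state \<Rightarrow> bool" where
  "stops_at G D h p S \<longleftrightarrow> step_t G D h p S = \<infinity>"

fun full_step :: "real^('x::finite + 'y::finite)^('x + 'y) \<Rightarrow> real^('x + 'y)^'m::finite \<Rightarrow> real^'m \<Rightarrow> 'm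
    \<Rightarrow> ('x, 'y, 'm) state \<Rightarrow> ('x, 'y, 'm) state \<Rightarrow> bool" where
  "full_step G D h p (z, \<alpha>, u) S' \<longleftrightarrow>
     step_t G D h p (z, \<alpha>, u) \<noteq> \<infinity> \<and>
     step_t G D h p (z, \<alpha>, u) = step_t2 G D h p (z, \<alpha>, u) \<and>
     S' = (step_z G D h p (z, \<alpha>, u), insert p \<alpha>, step_u G D h p (z, \<alpha>, u))"

text \<open>
  The minimum defining \<open>t\<^sub>1\<close> may be attained at several indices. The argument \<open>pick\<close> is a rule
  that selects one of them in each state; it only makes sense under \<open>tie_breaking\<close>.
\<close>

definition tie_breaking :: "real^('x::finite + 'y::finite)^('x + 'y) \<Rightarrow> real^('x + 'y)^'m::finite \<Rightarrow> 'm
    \<Rightarrow> (('x, 'y, 'm) state \<Rightarrow> 'm) \<Rightarrow> bool" where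
  "tie_breaking G D p pick \<longleftrightarrow>
     (\<forall>S. t1_attaining G D p S \<noteq> {} \<longrightarrow> pick S \<in> t1_attaining G D p S)"

fun partial_step :: "real^('x::finite + 'y::finite)^('x + 'y) \<Rightarrow> real^('x + 'y)^'m::finite \<Rightarrow> real^'m \<Rightarrow> 'm
    \<Rightarrow> (('x, 'y, 'm) state \<Rightarrow> 'm) \<Rightarrow> ('x, 'y, 'm) state \<Rightarrow> ('x, 'y, 'm) state \<Rightarrow> bool" where
  "partial_step G D h p pick (z, \<alpha>, u) S' \<longleftrightarrow>
     step_t G D h p (z, \<alpha>, u) \<noteq> \<infinity> \<and>
     step_t G D h p (z, \<alpha>, u) \<noteq> step_t2 G D h p (z, \<alpha>, u) \<and>
     (let k = pick (z, \<alpha>, u) in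
      S' = (step_z G D h p (z, \<alpha>, u), \<alpha> - {k},
            (\<chi> i. if i = k then 0 else step_u G D h p (z, \<alpha>, u) $ i)))"

end

theory Submission
  imports Defs
begin

text \<open>
  Positive definiteness of \<open>\<Gamma>\<^sub>\<alpha>\<close> together with independence of the rows of \<open>B\<^sub>\<alpha>\<close> is equivalent to
  negative definiteness of \<open>N\<^sub>\<alpha>\<^sup>TG\<^sup>-\<^sup>1N\<^sub>\<alpha>\<close>, and under it a point with all constraints of \<open>\<alpha>\<close> active and
  multipliers \<open>u \<le> 0\<close> is a local minimax point: the maximum over \<open>y\<close> is bounded below by the value
  at the equality-constrained maximizer, which is a convex quadratic in \<open>x\<close> with Hessian \<open>\<Gamma>\<^sub>\<alpha>\<close>.

  Along the procedure \<open>Gz + c + N\<^sub>\<alpha>u + u\<^sub>pn\<^sub>p = 0\<close>, \<open>u \<le> 0\<close> and \<open>s\<^sub>\<alpha>(z) = 0\<close> persist. The objective may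
  increase during partial steps, but the Lagrangian \<open>f(z) + u\<^sub>ps\<^sub>p(z)\<close> decreases, and it equals \<open>f\<close> at
  the start and after the full step. Moreover \<open>\<kappa> = s\<^sub>p(z) + u\<^sub>p n\<^sub>p\<^sup>TH\<^sub>\<alpha>n\<^sub>p\<close> stays positive: it is
  constant during a step, and dropping a constraint does not increase \<open>n\<^sub>p\<^sup>TH\<^sub>\<alpha>n\<^sub>p\<close> while \<open>u\<^sub>p \<le> 0\<close>.

  If the procedure stops with \<open>r \<ge> 0\<close> and \<open>n\<^sub>p\<^sup>TH\<^sub>\<alpha>n\<^sub>p \<ge> 0\<close>, a local minimax point \<open>w\<close> of
  \<open>P(\<alpha> \<union> {p})\<close> would be a KKT point with some multipliers \<open>v \<le> 0\<close>: Farkas' lemma gives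
  \<open>v\<close> from optimality in \<open>y\<close>, and since the Lagrangian with this \<open>v\<close> bounds the inner maximum from
  above, its \<open>x\<close>-gradient at \<open>w\<close> vanishes by minimality in \<open>x\<close>. Multiplying the KKT equations at
  \<open>w\<close> and at \<open>z\<close> by \<open>d\<close> gives \<open>s\<^sub>p(w) + r\<^sup>Ts\<^sub>\<alpha>(w) = \<kappa> - v\<^sub>p n\<^sub>p\<^sup>TH\<^sub>\<alpha>n\<^sub>p > 0\<close>, contradicting
  feasibility of \<open>w\<close>.
\<close>

section \<open>Vectors and matrices in block form\<close>

lemma sum_UNIV_Plus:
  "sum f (UNIV :: ('a::finite + 'b::finite) set) = (\<Sum>a\<in>UNIV. f (Inl a)) + (\<Sum>b\<in>UNIV. f (Inr b))"
  by (simp add: UNIV_Plus_UNIV[symmetric] sum.Plus comp_def del: UNIV_Plus_UNIV)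

lemma sum_indicator_mult:
  "(\<Sum>j\<in>UNIV. (if i = j then 1 else 0) * v j) = (v i :: real)" for i :: "'i::finite"
proof -
  have "(if i = j then 1 else 0) * v j = (if i = j then v j else 0)" for j by simp
  then show ?thesis by simp
qed

lemma join_nth [simp]: "join a b $ Inl i = a $ i" "join a b $ Inr j = b $ j"
  by (simp_all add: join_def)

lemma join_parts [simp]: "join (xpart z) (ypart z) = z"
  by (auto simp: vec_eq_iff xpart_def ypart_def join_def split: sum.split)

lemma parts_join [simp]: "xpart (join a b) = a" "ypart (join a b) = b"
  by (simp_all add: vec_eq_iff xpart_def ypart_def)

lemma join_add: "join a b + join a' b' = join (a + a') (b + b')"
  and join_scaleR: "t *\<^sub>R join a b = join (t *\<^sub>R a) (t *\<^sub>R b)"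
  by (auto simp: vec_eq_iff join_def split: sum.split)

lemma join_0 [simp]: "join 0 0 = 0"
  by (auto simp: vec_eq_iff join_def split: sum.split)

lemma inner_join: "join a b \<bullet> join a' b' = a \<bullet> a' + b \<bullet> b'"
  by (simp add: inner_vec_def sum_UNIV_Plus)

lemma parts_add [simp]: "xpart (z + w) = xpart z + xpart w" "ypart (z + w) = ypart z + ypart w"
  and parts_diff [simp]: "xpart (z - w) = xpart z - xpart w" "ypart (z - w) = ypart z - ypart w"
  by (simp_all add: vec_eq_iff xpart_def ypart_def)

lemma parts_0 [simp]: "xpart 0 = 0" "ypart 0 = 0"
  by (simp_all add: vec_eq_iff xpart_def ypart_def)

lemma inner_parts: "z \<bullet> w = xpart z \<bullet> xpart w + ypart z \<bullet> ypart w"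
  by (metis inner_join join_parts)

lemma hcat_mult_join: "hcat P Q *v join a b = P *v a + Q *v b"
  by (simp add: vec_eq_iff matrix_vector_mult_def hcat_def sum_UNIV_Plus)

lemma vcat_mult: "vcat P Q *v v = join (P *v v) (Q *v v)"
  by (auto simp: vec_eq_iff matrix_vector_mult_def vcat_def join_def split: sum.split)

lemma blocks_mult:
  assumes "transpose G = G"
  shows "G *v join a b = join (blk11 G *v a + blk12 G *v b) (transpose (blk12 G) *v a + blk22 G *v b)"
proof -
  have "G $ i $ j = G $ j $ i" for i j
    using arg_cong[OF assms, of "\<lambda>M. M $ j $ i"] by (simp add: transpose_def)
  then have G: "G = vcat (hcat (blk11 G) (blk12 G)) (hcat (transpose (blk12 G)) (blk22 G))"
    by (auto simp: vec_eq_iff blk11_def blk12_def blk22_def vcat_def hcat_def transpose_def split: sum.split)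
  show ?thesis
    by (subst (1) G) (simp add: vcat_mult hcat_mult_join)
qed

lemma row_join: "row i D = join (row i (Apart D)) (row i (Bpart D))"
  by (auto simp: vec_eq_iff row_def Apart_def Bpart_def join_def split: sum.split)

lemma rows_on_mult: "rows_on \<alpha> M *v v = (\<chi> i. if i \<in> \<alpha> then row i M \<bullet> v else 0)"
  by (auto simp: vec_eq_iff matrix_vector_mult_def rows_on_def row_def inner_vec_def)

lemma transpose_rows_on_mult:
  "transpose (rows_on \<alpha> M) *v u = (\<Sum>i\<in>\<alpha>. u $ i *\<^sub>R row i M)" for \<alpha> :: "'m::finite set"
proof -
  have "(\<Sum>i\<in>UNIV. (if i \<in> \<alpha> then M $ i $ j else 0) * u $ i) = (\<Sum>i\<in>\<alpha>. u $ i * M $ i $ j)" for j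
    by (rule sum.mono_neutral_cong_right) auto
  then show ?thesis
    by (simp add: vec_eq_iff matrix_vector_mult_def transpose_def rows_on_def row_def)
qed

text \<open>Injectivity makes rows and their indices interchangeable, so coefficients on the set of
  rows can be pulled back to coefficient vectors over the constraints.\<close>

lemma indep_rows_iff:
  fixes \<alpha> :: "'m::finite set" and M :: "real^'a^'m"
  shows "indep_rows \<alpha> M \<longleftrightarrow> (\<forall>u. (\<Sum>i\<in>\<alpha>. u $ i *\<^sub>R row i M) = 0 \<longrightarrow> (\<forall>i\<in>\<alpha>. u $ i = 0))"
    (is "?L \<longleftrightarrow> ?R")
proof
  assume L: ?L
  show ?R
  proof (intro allI impI)
    fix u assume "(\<Sum>i\<in>\<alpha>. u $ i *\<^sub>R row i M) = 0"
    moreover have "(\<Sum>i\<in>\<alpha>. u $ the_inv_into \<alpha> (\<lambda>i. row i M) (row i M) *\<^sub>R row i M) = (\<Sum>i\<in>\<alpha>. u $ i *\<^sub>R row i M)"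
      by (rule sum.cong) (use L the_inv_into_f_f[of "\<lambda>i. row i M" \<alpha>] in \<open>auto simp: indep_rows_def\<close>)
    ultimately have "(\<Sum>w\<in>(\<lambda>i. row i M) ` \<alpha>. u $ (the_inv_into \<alpha> (\<lambda>i. row i M) w) *\<^sub>R w) = 0"
      using L by (simp add: indep_rows_def sum.reindex comp_def)
    then have "\<forall>w\<in>(\<lambda>i. row i M) ` \<alpha>. u $ (the_inv_into \<alpha> (\<lambda>i. row i M) w) = 0"
      using L independentD[of "(\<lambda>i. row i M) ` \<alpha>" "(\<lambda>i. row i M) ` \<alpha>"
          "\<lambda>w. u $ (the_inv_into \<alpha> (\<lambda>i. row i M) w)"]
      by (auto simp: indep_rows_def)
    then show "\<forall>i\<in>\<alpha>. u $ i = 0"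
      using L the_inv_into_f_f[of "\<lambda>i. row i M" \<alpha>] by (auto simp: indep_rows_def)
  qed
next
  assume R: ?R
  have inj: "inj_on (\<lambda>i. row i M) \<alpha>"
  proof (rule inj_onI, rule ccontr)
    fix i j assume *: "i \<in> \<alpha>" "j \<in> \<alpha>" "row i M = row j M" "i \<noteq> j"
    \<comment> \<open>Two equal rows would satisfy the nontrivial relation with coefficient 1 at
      \<open>i\<close> and -1 at \<open>j\<close>.\<close>
    have "(axis i 1 - axis j 1 :: real^'m) $ k *\<^sub>R row k M
        = (if k = i then row k M else 0) - (if k = j then row k M else 0)" for k
      by (simp add: axis_def)
    then have "(\<Sum>k\<in>\<alpha>. (axis i 1 - axis j 1 :: real^'m) $ k *\<^sub>R row k M) = row i M - row j M"
      using *(1,2) by (simp add: sum_subtractf)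
    with R * have "(axis i 1 - axis j 1 :: real^'m) $ i = 0" by (metis right_minus_eq)
    with * show False by (simp add: axis_def)
  qed
  moreover have "independent ((\<lambda>i. row i M) ` \<alpha>)"
  proof (rule independent_if_scalars_zero)
    fix f w assume s: "(\<Sum>x\<in>(\<lambda>i. row i M) ` \<alpha>. f x *\<^sub>R x) = 0" and w: "w \<in> (\<lambda>i. row i M) ` \<alpha>"
    have "(\<Sum>i\<in>\<alpha>. (\<chi> i. f (row i M)) $ i *\<^sub>R row i M) = 0"
      using s by (simp add: sum.reindex[OF inj])
    with R have "\<forall>i\<in>\<alpha>. (\<chi> i. f (row i M)) $ i = 0" by blast
    with w show "f w = 0" by auto
  qed simp
  ultimately show ?L by (simp add: indep_rows_def)
qed

section \<open>Inverses of submatrices padded with zeros\<close>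

lemma matrix_inv_inverse:
  assumes "invertible A"
  shows "A ** matrix_inv A = mat 1" "matrix_inv A ** A = mat 1"
  using someI_ex[OF assms[unfolded invertible_def]] by (auto simp: matrix_inv_def)

definition supported_on :: "'i set \<Rightarrow> real^'i \<Rightarrow> bool" where
  "supported_on I v \<longleftrightarrow> (\<forall>i. i \<notin> I \<longrightarrow> v $ i = 0)"

text \<open>The choice in \<open>inv_on\<close> has a witness: extend the block of \<open>M\<close>
  on \<open>I\<close> by the identity, invert the whole matrix, and cut the inverse back to
  \<open>I\<close>. The hypothesis \<open>inj\<close> makes the extension invertible.\<close>

lemma inv_on_props:
  fixes M :: "real^'i::finite^'i"
  assumes inj: "\<And>v. supported_on I v \<Longrightarrow> (\<forall>i\<in>I. (M *v v) $ i = 0) \<Longrightarrow> v = 0"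
  shows "\<forall>i j. i \<notin> I \<or> j \<notin> I \<longrightarrow> inv_on I M $ i $ j = 0"
    and "\<forall>i\<in>I. \<forall>j\<in>I. (\<Sum>k\<in>I. M $ i $ k * inv_on I M $ k $ j) = (if i = j then 1 else 0) \<and>
                  (\<Sum>k\<in>I. inv_on I M $ i $ k * M $ k $ j) = (if i = j then 1 else 0)"
proof -
  define M' :: "real^'i^'i" where
    "M' = (\<chi> i j. if i \<in> I \<and> j \<in> I then M $ i $ j else if i = j then 1 else 0)"
  have M'1: "M' $ i $ j = M $ i $ j" if "i \<in> I" "j \<in> I" for i j
    using that by (simp add: M'_def)
  have M'2: "M' $ i $ j = (if i = j then 1 else 0)" if "i \<notin> I \<or> j \<notin> I" for i j
    using that by (auto simp: M'_def)
  have "v = 0" if v: "M' *v v = 0" for v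
  proof -
    have 0: "(\<Sum>j\<in>UNIV. M' $ i $ j * v $ j) = 0" for i
      using v by (simp add: vec_eq_iff matrix_vector_mult_def)
    have "v $ i = 0" if "i \<notin> I" for i
      using 0[of i] that by (simp add: M'2 sum_indicator_mult)
    then have s: "supported_on I v" by (simp add: supported_on_def)
    moreover have "(M *v v) $ i = 0" if "i \<in> I" for i
    proof -
      have "M $ i $ j * v $ j = M' $ i $ j * v $ j" for j
        using that s M'1[of i j] by (cases "j \<in> I") (auto simp: supported_on_def)
      then have "(M *v v) $ i = (\<Sum>j\<in>UNIV. M' $ i $ j * v $ j)"
        unfolding matrix_vector_mult_def vec_lambda_beta by (rule sum.cong[OF refl])
      then show ?thesis using 0 by simp
    qed
    ultimately show ?thesis using inj by blast
  qed
  then have "invertible M'"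
    by (simp add: invertible_left_inverse matrix_left_invertible_ker)
  then have id: "M' ** matrix_inv M' = mat 1" "matrix_inv M' ** M' = mat 1"
    by (simp_all add: matrix_inv_inverse)
  define X where "X = (\<chi> i j. if i \<in> I \<and> j \<in> I then matrix_inv M' $ i $ j else 0)"
  have "(\<Sum>k\<in>I. M $ i $ k * X $ k $ j) = (M' ** matrix_inv M') $ i $ j"
    if "i \<in> I" "j \<in> I" for i j
    unfolding matrix_matrix_mult_def vec_lambda_beta
    by (rule sum.mono_neutral_cong_left) (use that M'2 in \<open>auto simp: M'1 X_def\<close>)
  moreover have "(\<Sum>k\<in>I. X $ i $ k * M $ k $ j) = (matrix_inv M' ** M') $ i $ j"
    if "i \<in> I" "j \<in> I" for i j
    unfolding matrix_matrix_mult_def vec_lambda_beta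
    by (rule sum.mono_neutral_cong_left) (use that M'2 in \<open>auto simp: M'1 X_def\<close>)
  ultimately have "(\<forall>i j. i \<notin> I \<or> j \<notin> I \<longrightarrow> X $ i $ j = 0) \<and>
     (\<forall>i\<in>I. \<forall>j\<in>I. (\<Sum>k\<in>I. M $ i $ k * X $ k $ j) = (if i = j then 1 else 0) \<and>
                  (\<Sum>k\<in>I. X $ i $ k * M $ k $ j) = (if i = j then 1 else 0))"
    unfolding id by (auto simp: X_def mat_def)
  from someI[where P = "\<lambda>X. (\<forall>i j. i \<notin> I \<or> j \<notin> I \<longrightarrow> X $ i $ j = 0) \<and>
     (\<forall>i\<in>I. \<forall>j\<in>I. (\<Sum>k\<in>I. M $ i $ k * X $ k $ j) = (if i = j then 1 else 0) \<and>
                  (\<Sum>k\<in>I. X $ i $ k * M $ k $ j) = (if i = j then 1 else 0))", OF this]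
  show "\<forall>i j. i \<notin> I \<or> j \<notin> I \<longrightarrow> inv_on I M $ i $ j = 0"
    and "\<forall>i\<in>I. \<forall>j\<in>I. (\<Sum>k\<in>I. M $ i $ k * inv_on I M $ k $ j) = (if i = j then 1 else 0) \<and>
                  (\<Sum>k\<in>I. inv_on I M $ i $ k * M $ k $ j) = (if i = j then 1 else 0)"
    unfolding inv_on_def by blast+
qed

lemma inv_on_solve:
  fixes M :: "real^'i::finite^'i"
  assumes inj: "\<And>v. supported_on I v \<Longrightarrow> (\<forall>i\<in>I. (M *v v) $ i = 0) \<Longrightarrow> v = 0"
  shows "supported_on I (inv_on I M *v w)"
    and "i \<in> I \<Longrightarrow> (M *v (inv_on I M *v w)) $ i = w $ i"
    and "supported_on I v \<Longrightarrow> inv_on I M *v (M *v v) = v"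
proof -
  note X = inv_on_props[of I M, OF inj]
  show s: "supported_on I (inv_on I M *v w)" for w
    using X(1) by (simp add: supported_on_def matrix_vector_mult_def)
  show *: "(M *v (inv_on I M *v w)) $ i = w $ i" if "i \<in> I" for i w
  proof -
    have "(M *v (inv_on I M *v w)) $ i = (\<Sum>j\<in>UNIV. (\<Sum>k\<in>UNIV. M $ i $ k * inv_on I M $ k $ j) * w $ j)"
      unfolding matrix_vector_mul_assoc by (simp add: matrix_matrix_mult_def matrix_vector_mult_def)
    also have "\<dots> = (\<Sum>j\<in>UNIV. (if i = j then 1 else 0) * w $ j)"
    proof (rule sum.cong)
      fix j
      have "(\<Sum>k\<in>UNIV. M $ i $ k * inv_on I M $ k $ j) = (\<Sum>k\<in>I. M $ i $ k * inv_on I M $ k $ j)"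
        by (rule sum.mono_neutral_right) (use X(1) in auto)
      also have "\<dots> = (if i = j then 1 else 0)"
        using X that by (cases "j \<in> I") auto
      finally show "(\<Sum>k\<in>UNIV. M $ i $ k * inv_on I M $ k $ j) * w $ j = (if i = j then 1 else 0) * w $ j"
        by simp
    qed simp
    also have "\<dots> = w $ i" by (rule sum_indicator_mult)
    finally show ?thesis .
  qed
  show "inv_on I M *v (M *v v) = v" if "supported_on I v"
  proof -
    \<comment> \<open>The difference is supported on \<open>I\<close>, and \<open>M\<close> sends it
      to a vector that vanishes on \<open>I\<close>.\<close>
    have "inv_on I M *v (M *v v) - v = 0"
      by (rule inj) (use s[of "M *v v"] that * in
          \<open>auto simp: supported_on_def matrix_vector_mult_diff_distrib\<close>)
    then show ?thesis by simp
  qed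
qed

section \<open>Combinations of rows, transposes and Farkas' lemma\<close>

declare transpose_matrix_vector [simp del]

text \<open>\<open>comb D \<alpha> u\<close> is \<open>N\<^sub>\<alpha>u\<close>. Entries of
  \<open>u\<close> outside \<alpha> are ignored, so that one vector can hold the multipliers for
  \<alpha> and for \<open>insert p \<alpha>\<close>.\<close>

definition comb :: "real^'n^'m \<Rightarrow> 'm set \<Rightarrow> real^'m \<Rightarrow> real^'n" where
  "comb M \<alpha> u = (\<Sum>i\<in>\<alpha>. u $ i *\<^sub>R row i M)"

lemma inner_comb: "comb M \<alpha> u \<bullet> w = (\<Sum>i\<in>\<alpha>. u $ i * (row i M \<bullet> w))"
  by (simp add: comb_def inner_sum_left)

lemma inner_comb_eq_0: "(\<And>i. i \<in> \<alpha> \<Longrightarrow> row i M \<bullet> w = 0) \<Longrightarrow> comb M \<alpha> u \<bullet> w = 0"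
  by (simp add: inner_comb)

lemma comb_add: "comb M \<alpha> (u + v) = comb M \<alpha> u + comb M \<alpha> v"
  and comb_diff: "comb M \<alpha> (u - v) = comb M \<alpha> u - comb M \<alpha> v"
  and comb_uminus: "comb M \<alpha> (- u) = - comb M \<alpha> u"
  and comb_scaleR: "comb M \<alpha> (t *\<^sub>R u) = t *\<^sub>R comb M \<alpha> u"
  by (simp_all add: comb_def scaleR_left_distrib scaleR_left_diff_distrib sum.distrib sum_subtractf
      sum_negf scaleR_sum_right)

lemma comb_eq_0: "(\<And>i. i \<in> \<alpha> \<Longrightarrow> u $ i = 0) \<Longrightarrow> comb M \<alpha> u = 0"
  by (simp add: comb_def)

lemma comb_mono:
  fixes \<beta> :: "'m::finite set"
  assumes "\<alpha> \<subseteq> \<beta>" "\<And>i. i \<in> \<beta> - \<alpha> \<Longrightarrow> u $ i = 0"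
  shows "comb M \<beta> u = comb M \<alpha> u"
  unfolding comb_def by (rule sum.mono_neutral_right) (use assms in auto)

lemma comb_insert:
  fixes \<alpha> :: "'m::finite set"
  shows "p \<notin> \<alpha> \<Longrightarrow> comb M (insert p \<alpha>) u = u $ p *\<^sub>R row p M + comb M \<alpha> u"
  by (simp add: comb_def)

lemma comb_parts: "xpart (comb D \<alpha> u) = comb (Apart D) \<alpha> u" "ypart (comb D \<alpha> u) = comb (Bpart D) \<alpha> u"
  by (simp_all add: vec_eq_iff xpart_def ypart_def comb_def row_def Apart_def Bpart_def)

lemma comb_join: "comb D \<alpha> u = join (comb (Apart D) \<alpha> u) (comb (Bpart D) \<alpha> u)"
  by (metis comb_parts join_parts)

lemma inner_row_join: "row i D \<bullet> join a b = row i (Apart D) \<bullet> a + row i (Bpart D) \<bullet> b"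
  by (metis row_join inner_join)

lemma Nmat_mult: "Nmat D \<alpha> *v u = comb D \<alpha> u"
  by (simp add: Nmat_def transpose_rows_on_mult comb_def)

lemma transpose_Nmat_mult: "transpose (Nmat D \<alpha>) *v w = (\<chi> i. if i \<in> \<alpha> then row i D \<bullet> w else 0)"
  by (simp add: Nmat_def rows_on_mult)

lemma symmetric_inner:
  fixes M :: "real^'a::finite^'a"
  assumes "transpose M = M"
  shows "(M *v a) \<bullet> b = a \<bullet> (M *v b)"
  by (metis assms dot_lmul_matrix transpose_matrix_vector)

lemma transpose_inner:
  fixes M :: "real^'a::finite^'b::finite"
  shows "(transpose M *v a) \<bullet> b = a \<bullet> (M *v b)"
  by (metis dot_lmul_matrix transpose_matrix_vector)

lemma symmetricI:
  fixes M :: "real^'a::finite^'a"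
  assumes "\<And>a b. a \<bullet> (M *v b) = b \<bullet> (M *v a)"
  shows "transpose M = M"
proof -
  have "transpose M *v a = M *v a" for a
  proof (rule vector_eq_ldot[THEN iffD1], rule allI)
    fix b show "b \<bullet> (transpose M *v a) = b \<bullet> (M *v a)"
      using transpose_inner[of M a b] assms[of a b] by (simp add: inner_commute)
  qed
  then show ?thesis by (simp add: matrix_eq)
qed

lemma invertible_if_injective:
  fixes M :: "real^'a::finite^'a"
  assumes "\<And>v. M *v v = 0 \<Longrightarrow> v = 0"
  shows "invertible M"
  using assms by (simp add: invertible_left_inverse matrix_left_invertible_ker)

lemma matrix_inv_mult:
  fixes M :: "real^'a::finite^'a"
  assumes "invertible M"
  shows "M *v (matrix_inv M *v v) = v" "matrix_inv M *v (M *v v) = v"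
  using matrix_inv_inverse[OF assms] by (simp_all add: matrix_vector_mul_assoc)

lemma uminus_matrix_vector_mult: "(- M) *v v = - (M *v v)" for M :: "real^'a::finite^'b"
  by (simp add: vec_eq_iff matrix_vector_mult_def sum_negf)

lemma matrix_vector_mult_uminus: "M *v (- v) = - (M *v v)" for M :: "real^'a::finite^'b"
  by (simp add: vec_eq_iff matrix_vector_mult_def sum_negf)

lemma comb_indep:
  fixes M :: "real^'n^'m::finite"
  assumes "indep_rows \<alpha> M" "comb M \<alpha> u = 0" "i \<in> \<alpha>"
  shows "u $ i = 0"
  using assms by (auto simp: indep_rows_iff comb_def)

text \<open>If \<open>g\<close> were outside the closed convex cone generated by the rows, a
  separating normal \<open>a\<close> would give a direction \<open>- a\<close> that violates the
  assumption.\<close>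

lemma farkas:
  fixes M :: "real^'n::finite^'m::finite"
  assumes "\<And>e. (\<And>i. i \<in> \<beta> \<Longrightarrow> row i M \<bullet> e \<le> 0) \<Longrightarrow> g \<bullet> e \<le> 0"
  shows "\<exists>\<mu>. supported_on \<beta> \<mu> \<and> (\<forall>i. 0 \<le> \<mu> $ i) \<and> g = comb M \<beta> \<mu>"
proof -
  define H where "H = convex_cone hull ((\<lambda>i. row i M) ` \<beta>)"
  define C where "C = {comb M \<beta> \<mu> | \<mu>. supported_on \<beta> \<mu> \<and> (\<forall>i. 0 \<le> \<mu> $ i)}"
  have "H \<subseteq> C"
    unfolding H_def
  proof (rule hull_minimal)
    show "(\<lambda>i. row i M) ` \<beta> \<subseteq> C"
    proof clarify
      fix i assume i: "i \<in> \<beta>"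
      have "axis i 1 $ j *\<^sub>R row j M = (if j = i then row j M else 0)" for j
        by (simp add: axis_def)
      then have "comb M \<beta> (axis i 1) = row i M"
        using i by (simp add: comb_def)
      then show "row i M \<in> C"
        unfolding C_def using i
        by (intro CollectI exI[of _ "axis i 1"]) (auto simp: supported_on_def axis_def)
    qed
    have "x + y \<in> C" if "x \<in> C" "y \<in> C" for x y
    proof -
      from that obtain \<mu> \<nu> where *: "x = comb M \<beta> \<mu>" "y = comb M \<beta> \<nu>"
        "supported_on \<beta> \<mu>" "supported_on \<beta> \<nu>" "\<forall>i. 0 \<le> \<mu> $ i" "\<forall>i. 0 \<le> \<nu> $ i"
        by (auto simp: C_def)
      then show ?thesis
        unfolding C_def by (intro CollectI exI[of _ "\<mu> + \<nu>"]) (auto simp: comb_add supported_on_def)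
    qed
    moreover have "t *\<^sub>R x \<in> C" if "x \<in> C" "0 \<le> t" for x t
    proof -
      from that obtain \<mu> where *: "x = comb M \<beta> \<mu>" "supported_on \<beta> \<mu>" "\<forall>i. 0 \<le> \<mu> $ i"
        by (auto simp: C_def)
      then show ?thesis
        unfolding C_def using that
        by (intro CollectI exI[of _ "t *\<^sub>R \<mu>"]) (auto simp: comb_scaleR supported_on_def)
    qed
    moreover have "0 \<in> C"
      unfolding C_def by (intro CollectI exI[of _ 0]) (auto simp: comb_def supported_on_def)
    ultimately show "convex_cone C" by (auto simp: convex_cone_iff)
  qed
  moreover have "g \<in> H"
  proof (rule ccontr)
    assume "g \<notin> H"
    moreover have "convex H" "closed H"
      by (simp_all add: H_def convex_convex_cone_hull closed_convex_cone_hull)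
    ultimately obtain a b where ab: "a \<bullet> g < b" "\<And>x. x \<in> H \<Longrightarrow> a \<bullet> x > b"
      using separating_hyperplane_closed_point[of H g] by blast
    have "b < 0" using ab(2)[of 0] by (simp add: H_def convex_cone_hull_contains_0)
    have "row i M \<bullet> (- a) \<le> 0" if "i \<in> \<beta>" for i
    proof (rule ccontr)
      assume "\<not> row i M \<bullet> (- a) \<le> 0"
      then have neg: "a \<bullet> row i M < 0" by (simp add: inner_commute)
      \<comment> \<open>This multiple of the row has inner product exactly \<open>b\<close> with
        \<open>a\<close>, which strict separation forbids.\<close>
      have "(b / (a \<bullet> row i M)) *\<^sub>R row i M \<in> H"
        unfolding H_def
        by (rule convex_cone_hull_mul[OF hull_inc])
          (use that neg \<open>b < 0\<close> in \<open>auto simp: divide_nonpos_neg\<close>)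
      from ab(2)[OF this] neg show False by simp
    qed
    from assms[OF this] ab(1) \<open>b < 0\<close> show False by (simp add: inner_commute)
  qed
  ultimately show ?thesis by (auto simp: C_def)
qed

section \<open>Saddle matrices\<close>

locale saddle_matrix =
  fixes G :: "real^('x::finite + 'y::finite)^('x + 'y)"
  assumes sym: "transpose G = G"
    and neg: "posdef (- blk22 G)"
    and schur: "posdef (blk11 G - blk12 G ** matrix_inv (blk22 G) ** transpose (blk12 G))"
begin

abbreviation "Ginv \<equiv> matrix_inv G"
abbreviation "Schur \<equiv> blk11 G - blk12 G ** matrix_inv (blk22 G) ** transpose (blk12 G)"

lemma G_inner: "(G *v a) \<bullet> b = a \<bullet> (G *v b)"
  by (rule symmetric_inner[OF sym])

lemma blk22_neg: "v \<noteq> 0 \<Longrightarrow> v \<bullet> (blk22 G *v v) < 0"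
  using neg by (simp add: posdef_def uminus_matrix_vector_mult)

lemma blk22_nonpos: "v \<bullet> (blk22 G *v v) \<le> 0"
  using blk22_neg[of v] by (cases "v = 0") auto

lemma Schur_pos: "v \<noteq> 0 \<Longrightarrow> v \<bullet> (Schur *v v) > 0"
  using schur by (simp add: posdef_def)

lemma Schur_nonneg: "v \<bullet> (Schur *v v) \<ge> 0"
  using Schur_pos[of v] by (cases "v = 0") auto

lemma blk22_inner: "(blk22 G *v a) \<bullet> b = a \<bullet> (blk22 G *v b)"
proof -
  have "((- blk22 G) *v a) \<bullet> b = a \<bullet> ((- blk22 G) *v b)"
    by (rule symmetric_inner) (use neg in \<open>simp add: posdef_def\<close>)
  then show ?thesis by (simp add: uminus_matrix_vector_mult)
qed

lemma invertible_blk22: "invertible (blk22 G)"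
  by (rule invertible_if_injective) (use blk22_neg in force)

text \<open>For fixed x the quadratic form is largest at
  \<open>y = - matrix_inv (blk22 G) *v (transpose (blk12 G) *v x)\<close>. This is the displacement
  of y from that maximizer.\<close>

definition ycenter :: "real^('x + 'y) \<Rightarrow> real^'y" where
  "ycenter z = ypart z + matrix_inv (blk22 G) *v (transpose (blk12 G) *v xpart z)"

lemma ypart_G: "ypart (G *v z) = blk22 G *v ycenter z"
  using blocks_mult[OF sym, of "xpart z" "ypart z"]
  by (simp add: ycenter_def matrix_vector_right_distrib matrix_inv_mult[OF invertible_blk22])

text \<open>Completing the square in y. The cross terms agree because \<open>blk22 G\<close> is
  symmetric and maps the shift \<open>k\<close> to \<open>transpose (blk12 G) *v a\<close>.\<close>

lemma quadratic_form_split: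
  "z \<bullet> (G *v z) = xpart z \<bullet> (Schur *v xpart z) + ycenter z \<bullet> (blk22 G *v ycenter z)"
proof -
  define a b where "a = xpart z" and "b = ypart z"
  define k where "k = matrix_inv (blk22 G) *v (transpose (blk12 G) *v a)"
  have k: "blk22 G *v k = transpose (blk12 G) *v a"
    by (simp add: k_def matrix_inv_mult[OF invertible_blk22])
  have w: "ycenter z = b + k" by (simp add: ycenter_def a_def b_def k_def)
  have S: "Schur *v a = blk11 G *v a - blk12 G *v k"
    by (simp add: matrix_vector_mult_diff_rdistrib k_def matrix_vector_mul_assoc matrix_mul_assoc)
  have "z = join a b" by (simp add: a_def b_def)
  then have "z \<bullet> (G *v z) = a \<bullet> (blk11 G *v a) + a \<bullet> (blk12 G *v b)
      + b \<bullet> (transpose (blk12 G) *v a) + b \<bullet> (blk22 G *v b)"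
    by (simp add: blocks_mult[OF sym] inner_join inner_add_right)
  moreover have "k \<bullet> (blk22 G *v b) = b \<bullet> (transpose (blk12 G) *v a)"
    using blk22_inner[of k b] by (simp add: k inner_commute)
  moreover have "a \<bullet> (blk12 G *v k) = k \<bullet> (transpose (blk12 G) *v a)"
    "a \<bullet> (blk12 G *v b) = b \<bullet> (transpose (blk12 G) *v a)"
    using transpose_inner[of "blk12 G" a] by (simp_all add: inner_commute)
  ultimately show ?thesis
    unfolding w S a_def[symmetric]
    by (simp add: matrix_vector_right_distrib k inner_add_left inner_add_right inner_diff_right)
qed

lemma quadratic_form_le: "z \<bullet> (G *v z) \<le> xpart z \<bullet> (Schur *v xpart z)"
  using quadratic_form_split[of z] blk22_nonpos[of "ycenter z"] by simp

lemma quadratic_form_eq: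
  assumes "ypart (G *v z) = 0"
  shows "z \<bullet> (G *v z) = xpart z \<bullet> (Schur *v xpart z)"
  using quadratic_form_split[of z] assms by (simp add: ypart_G)

lemma quadratic_form_join_0: "join 0 b \<bullet> (G *v join 0 b) = b \<bullet> (blk22 G *v b)"
  by (simp add: blocks_mult[OF sym] inner_join)

lemma invertible_G: "invertible G"
proof (rule invertible_if_injective)
  fix v assume v: "G *v v = 0"
  then have "blk22 G *v ycenter v = 0" by (metis ypart_G parts_0(2))
  then have y: "ycenter v = 0" using blk22_neg by force
  have "xpart v \<bullet> (Schur *v xpart v) = 0"
    using quadratic_form_eq[of v] v by simp
  then have x: "xpart v = 0" using Schur_pos by force
  then have "ypart v = 0" using y by (simp add: ycenter_def)
  with x show "v = 0" by (metis join_0 join_parts)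
qed

lemmas G_Ginv [simp] = matrix_inv_mult[OF invertible_G]

text \<open>Negative definiteness of
  \<open>N\<^sub>\<alpha>\<^sup>TG\<^sup>-\<^sup>1N\<^sub>\<alpha>\<close>. It stands in for the
  conditions on \<open>\<Gamma>\<^sub>\<alpha>\<close> and \<open>B\<^sub>\<alpha>\<close>
  throughout the procedure, since it passes to subsets at once.\<close>

definition negdef_on :: "real^('x + 'y)^'m \<Rightarrow> 'm set \<Rightarrow> bool" where
  "negdef_on D \<alpha> \<longleftrightarrow> (\<forall>u. (\<exists>i\<in>\<alpha>. u $ i \<noteq> 0) \<longrightarrow> comb D \<alpha> u \<bullet> (Ginv *v comb D \<alpha> u) < 0)"

lemma negdef_onD: "negdef_on D \<alpha> \<Longrightarrow> i \<in> \<alpha> \<Longrightarrow> u $ i \<noteq> 0 \<Longrightarrow> comb D \<alpha> u \<bullet> (Ginv *v comb D \<alpha> u) < 0"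
  by (auto simp: negdef_on_def)

lemma negdef_on_le:
  assumes "negdef_on D \<alpha>"
  shows "comb D \<alpha> u \<bullet> (Ginv *v comb D \<alpha> u) \<le> 0"
proof (cases "\<exists>i\<in>\<alpha>. u $ i \<noteq> 0")
  case True then show ?thesis using assms by (auto simp: negdef_on_def less_imp_le)
next
  case False then show ?thesis by (simp add: comb_eq_0)
qed

lemma negdef_on_subset:
  fixes D :: "real^('x + 'y)^'m::finite"
  assumes "negdef_on D \<beta>" "\<alpha> \<subseteq> \<beta>"
  shows "negdef_on D \<alpha>"
  unfolding negdef_on_def
proof (intro allI impI)
  fix u :: "real^'m" assume u: "\<exists>i\<in>\<alpha>. u $ i \<noteq> 0"
  define v :: "real^'m" where "v = (\<chi> i. if i \<in> \<alpha> then u $ i else 0)"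
  have "comb D \<beta> v = comb D \<alpha> v"
    by (rule comb_mono) (use assms in \<open>auto simp: v_def\<close>)
  also have "\<dots> = comb D \<alpha> u" by (simp add: comb_def v_def)
  finally have eq: "comb D \<beta> v = comb D \<alpha> u" .
  have "\<exists>i\<in>\<beta>. v $ i \<noteq> 0" using u assms by (auto simp: v_def)
  then show "comb D \<alpha> u \<bullet> (Ginv *v comb D \<alpha> u) < 0"
    using assms(1) unfolding eq[symmetric] negdef_on_def by blast
qed

section \<open>The operators \<open>Nstar\<close> and \<open>Hmat\<close> and the step
  direction\<close>

context
  fixes D :: "real^('x + 'y)^'m::finite" and \<alpha> :: "'m set"
  assumes nd: "negdef_on D \<alpha>"
begin

private lemma gram_mult:
  "(transpose (Nmat D \<alpha>) ** Ginv ** Nmat D \<alpha>) *v u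
    = (\<chi> i. if i \<in> \<alpha> then row i D \<bullet> (Ginv *v comb D \<alpha> u) else 0)"
  by (simp add: matrix_vector_mul_assoc[symmetric] Nmat_mult transpose_Nmat_mult)

text \<open>A vector in the kernel has value zero under a negative definite form. This supplies the
  hypothesis of \<open>inv_on_solve\<close>, so that \<open>inv_on\<close> in \<open>Nstar\<close>
  is a true inverse.\<close>

private lemma gram_nonsingular:
  assumes s: "supported_on \<alpha> v"
    and 0: "\<forall>i\<in>\<alpha>. ((transpose (Nmat D \<alpha>) ** Ginv ** Nmat D \<alpha>) *v v) $ i = 0"
  shows "v = 0"
proof -
  have "comb D \<alpha> v \<bullet> (Ginv *v comb D \<alpha> v) = 0"
    by (rule inner_comb_eq_0) (use 0 in \<open>simp add: gram_mult\<close>)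
  then have "\<forall>i\<in>\<alpha>. v $ i = 0" using nd by (force simp: negdef_on_def)
  then show ?thesis using s by (auto simp: vec_eq_iff supported_on_def)
qed

private lemma Nstar_mult:
  "Nstar G D \<alpha> *v w = inv_on \<alpha> (transpose (Nmat D \<alpha>) ** Ginv ** Nmat D \<alpha>)
     *v (transpose (Nmat D \<alpha>) *v (Ginv *v w))"
  by (simp add: Nstar_def matrix_vector_mul_assoc[symmetric])

lemma Nstar_supported: "supported_on \<alpha> (Nstar G D \<alpha> *v w)"
  unfolding Nstar_mult by (rule inv_on_solve(1)[OF gram_nonsingular])

lemma Nstar_comb:
  assumes "supported_on \<alpha> u"
  shows "Nstar G D \<alpha> *v comb D \<alpha> u = u"
proof -
  have "transpose (Nmat D \<alpha>) *v (Ginv *v comb D \<alpha> u)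
      = (transpose (Nmat D \<alpha>) ** Ginv ** Nmat D \<alpha>) *v u"
    by (simp add: gram_mult transpose_Nmat_mult)
  then show ?thesis
    unfolding Nstar_mult using inv_on_solve(3)[OF gram_nonsingular assms] by simp
qed

text \<open>The normal equations: \<open>comb D \<alpha> (Nstar G D \<alpha> *v w)\<close> is the
  projection of \<open>w\<close> onto the span of the active normals with respect to the indefinite
  form of \<open>Ginv\<close>.\<close>

lemma row_Nstar:
  assumes "i \<in> \<alpha>"
  shows "row i D \<bullet> (Ginv *v comb D \<alpha> (Nstar G D \<alpha> *v w)) = row i D \<bullet> (Ginv *v w)"
proof -
  have "((transpose (Nmat D \<alpha>) ** Ginv ** Nmat D \<alpha>) *v (Nstar G D \<alpha> *v w)) $ i
      = (transpose (Nmat D \<alpha>) *v (Ginv *v w)) $ i"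
    unfolding Nstar_mult by (rule inv_on_solve(2)[OF gram_nonsingular assms])
  then show ?thesis using assms by (simp add: gram_mult transpose_Nmat_mult)
qed

lemma Hmat_mult: "Hmat G D \<alpha> *v w = Ginv *v w - Ginv *v comb D \<alpha> (Nstar G D \<alpha> *v w)"
  by (simp add: Hmat_def matrix_vector_mult_diff_rdistrib Nstar_mult matrix_vector_mul_assoc[symmetric]
      Nmat_mult)

lemma step_r_supported: "supported_on \<alpha> (step_r G D p \<alpha>)"
  using Nstar_supported by (simp add: step_r_def supported_on_def)

text \<open>Together with \<open>row_step_d\<close> this is the KKT system of the step:
  \<open>d\<close> is tangent to the active constraints, and \<open>r\<close> with entry 1 at
  \<open>p\<close> gives the rates at which the multipliers change.\<close>

lemma G_step_d: "G *v step_d G D p \<alpha> = row p D + comb D \<alpha> (step_r G D p \<alpha>)"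
  by (simp add: step_d_def step_r_def Hmat_mult matrix_vector_mult_diff_distrib comb_uminus)

lemma row_step_d: "i \<in> \<alpha> \<Longrightarrow> row i D \<bullet> step_d G D p \<alpha> = 0"
  by (simp add: step_d_def Hmat_mult inner_diff_right row_Nstar)

lemma multipliers_eq:
  assumes "supported_on \<alpha> u" "G *v z + c + comb D \<alpha> u = 0"
  shows "multipliers G c D z \<alpha> = u"
proof -
  have "grad G c z = comb D \<alpha> (- u)"
    using assms(2) by (simp add: grad_def comb_uminus eq_neg_iff_add_eq_0)
  moreover have "Nstar G D \<alpha> *v comb D \<alpha> (- u) = - u"
    by (rule Nstar_comb) (use assms(1) in \<open>simp add: supported_on_def\<close>)
  ultimately show ?thesis by (simp add: multipliers_def)
qed

text \<open>The component of \<open>G *v d\<close> in the span of the active normals is orthogonal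
  to \<open>d\<close>. Hence the curvature of the objective along \<open>d\<close> equals the slope
  of the slack of \<open>p\<close>.\<close>

lemma step_d_quadratic: "step_d G D p \<alpha> \<bullet> (G *v step_d G D p \<alpha>) = row p D \<bullet> step_d G D p \<alpha>"
proof -
  have "comb D \<alpha> (step_r G D p \<alpha>) \<bullet> step_d G D p \<alpha> = 0"
    by (rule inner_comb_eq_0) (rule row_step_d)
  then show ?thesis by (simp add: G_step_d inner_add_right inner_commute)
qed

end


section \<open>Negative definiteness on \<alpha> and the matrix
  \<open>\<Gamma>\<^sub>\<alpha>\<close>\<close>

lemma Ginv_nonneg:
  assumes "ypart e = 0"
  shows "e \<bullet> (Ginv *v e) = xpart (Ginv *v e) \<bullet> (Schur *v xpart (Ginv *v e))"
  using quadratic_form_eq[of "Ginv *v e"] assms by (simp add: inner_commute)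

text \<open>A combination whose y-part vanishes has a nonnegative value under the form of
  \<open>Ginv\<close>, by \<open>Ginv_nonneg\<close>, so negative definiteness forces its
  coefficients to be zero.\<close>

lemma indep_rows_Bpart_if_negdef:
  fixes D :: "real^('x + 'y)^'m::finite"
  assumes "negdef_on D \<alpha>"
  shows "indep_rows \<alpha> (Bpart D)"
  unfolding indep_rows_iff
proof (intro allI impI ballI)
  fix u :: "real^'m" and i
  assume u: "(\<Sum>i\<in>\<alpha>. u $ i *\<^sub>R row i (Bpart D)) = 0" and i: "i \<in> \<alpha>"
  have "ypart (comb D \<alpha> u) = 0" unfolding comb_parts using u by (simp add: comb_def)
  then have "comb D \<alpha> u \<bullet> (Ginv *v comb D \<alpha> u) \<ge> 0"
    using Schur_nonneg by (simp add: Ginv_nonneg)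
  then show "u $ i = 0" using negdef_onD[OF assms i, of u] by force
qed

lemma indep_rows_if_Bpart:
  fixes D :: "real^('x + 'y)^'m::finite"
  assumes "indep_rows \<alpha> (Bpart D)"
  shows "indep_rows \<alpha> D"
  unfolding indep_rows_iff
proof (intro allI impI ballI)
  fix u :: "real^'m" and i
  assume "(\<Sum>i\<in>\<alpha>. u $ i *\<^sub>R row i D) = 0" and i: "i \<in> \<alpha>"
  then have "comb D \<alpha> u = 0" by (simp add: comb_def)
  then have "comb (Bpart D) \<alpha> u = 0" by (metis comb_parts(2) parts_0(2))
  then show "u $ i = 0" using comb_indep[OF assms _ i] by simp
qed

text \<open>\<open>W v\<close> is the response in y to a move \<open>v\<close> in x that keeps the
  constraints of \<alpha> active and, with suitable multipliers, stays stationary in y. The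
  remaining x-gradient is \<open>Gamma_mat G D \<alpha> *v v\<close>.\<close>

lemma Gamma_solve:
  fixes D :: "real^('x + 'y)^'m::finite"
  assumes indep: "indep_rows \<alpha> (Bpart D)"
  obtains W where "linear W"
    and "\<And>v. \<exists>\<mu>. G *v join v (W v) + comb D \<alpha> \<mu> = join (Gamma_mat G D \<alpha> *v v) 0"
    and "\<And>v i. i \<in> \<alpha> \<Longrightarrow> row i D \<bullet> join v (W v) = 0"
proof -
  define P where "P = vcat (hcat (blk22 G) (transpose (rows_on \<alpha> (Bpart D)))) (hcat (rows_on \<alpha> (Bpart D)) 0)"
  define R where "R = vcat (transpose (blk12 G)) (rows_on \<alpha> (Apart D))"
  define X where "X = inv_on (UNIV <+> \<alpha>) P"
  have P: "P *v join y \<mu> = join (blk22 G *v y + comb (Bpart D) \<alpha> \<mu>)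
      (\<chi> i. if i \<in> \<alpha> then row i (Bpart D) \<bullet> y else 0)" for y \<mu>
    by (simp add: P_def vcat_mult hcat_mult_join transpose_rows_on_mult rows_on_mult comb_def)
  have R: "R *v v = join (transpose (blk12 G) *v v)
      (\<chi> i. if i \<in> \<alpha> then row i (Apart D) \<bullet> v else 0)" for v
    by (simp add: R_def vcat_mult rows_on_mult)
  \<comment> \<open>Pairing the first block equation with \<open>y\<close> removes the multiplier
    term, so \<open>y = 0\<close> by negative definiteness of \<open>blk22 G\<close>; independence
    of the rows of \<open>B\<^sub>\<alpha>\<close> then gives \<open>\<mu> = 0\<close>.\<close>
  have nonsing: "s = 0"
    if s: "supported_on (UNIV <+> \<alpha>) s" "\<forall>i\<in>UNIV <+> \<alpha>. (P *v s) $ i = 0" for s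
  proof -
    define y \<mu> where "y = xpart s" and "\<mu> = ypart s"
    have sj: "s = join y \<mu>" by (simp add: y_def \<mu>_def)
    have "(P *v s) $ Inl a = 0" for a using s(2) by auto
    then have y: "blk22 G *v y + comb (Bpart D) \<alpha> \<mu> = 0"
      by (simp add: sj P vec_eq_iff)
    have B: "row i (Bpart D) \<bullet> y = 0" if "i \<in> \<alpha>" for i
    proof -
      have "(P *v s) $ Inr i = 0" using s(2) that by auto
      then show ?thesis using that by (simp add: sj P)
    qed
    have "y \<bullet> (blk22 G *v y) + y \<bullet> comb (Bpart D) \<alpha> \<mu> = 0"
      using arg_cong[OF y, of "\<lambda>q. y \<bullet> q"] by (simp add: inner_add_right)
    then have "y \<bullet> (blk22 G *v y) = 0"
      using inner_comb_eq_0[OF B] by (simp add: inner_commute)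
    then have y0: "y = 0" using blk22_neg by force
    then have "comb (Bpart D) \<alpha> \<mu> = 0" using y by simp
    then have "\<mu> $ i = 0" if "i \<in> \<alpha>" for i
      using comb_indep[OF indep] that by blast
    moreover have "\<mu> $ i = 0" if "i \<notin> \<alpha>" for i
      using s(1) that by (auto simp: supported_on_def \<mu>_def ypart_def)
    ultimately have "\<mu> = 0" by (metis vec_eq_iff zero_index)
    with y0 sj show ?thesis by simp
  qed
  have sol: "(P *v (X *v (R *v v))) $ i = (R *v v) $ i" if "i \<in> UNIV <+> \<alpha>" for i v
    unfolding X_def by (rule inv_on_solve(2)[OF nonsing that])
  \<comment> \<open>The minus signs come from the one in front of the block product in
    \<open>Gamma_mat\<close>.\<close>
  define W where "W = (\<lambda>v. - xpart (X *v (R *v v)))"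
  define \<mu> where "\<mu> = (\<lambda>v. - ypart (X *v (R *v v)))"
  have XR: "X *v (R *v v) = join (- W v) (- \<mu> v)" for v
    by (simp add: W_def \<mu>_def)
  have yeq: "transpose (blk12 G) *v v + blk22 G *v W v + comb (Bpart D) \<alpha> (\<mu> v) = 0" for v
  proof -
    have "(P *v join (- W v) (- \<mu> v)) $ Inl a = (R *v v) $ Inl a" for a
      unfolding XR[symmetric] by (rule sol) auto
    then have "blk22 G *v (- W v) + comb (Bpart D) \<alpha> (- \<mu> v) = transpose (blk12 G) *v v"
      unfolding P R by (simp add: vec_eq_iff)
    then show ?thesis
      unfolding eq_commute[of _ "transpose (blk12 G) *v v"] by (simp add: comb_uminus matrix_vector_mult_uminus)
  qed
  show thesis
  proof
    show "linear W"
      unfolding W_def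
      by (rule linearI)
        (simp_all add: vec_eq_iff xpart_def matrix_vector_right_distrib scaleR_matrix_vector_assoc[symmetric]
          matrix_vector_mult_scaleR)
    show "\<exists>\<mu>. G *v join v (W v) + comb D \<alpha> \<mu> = join (Gamma_mat G D \<alpha> *v v) 0" for v
    proof
      have "Gamma_mat G D \<alpha> *v v = blk11 G *v v
          - hcat (blk12 G) (transpose (rows_on \<alpha> (Apart D))) *v (X *v (R *v v))"
        by (simp add: Gamma_mat_def Let_def X_def P_def R_def matrix_vector_mult_diff_rdistrib
            matrix_vector_mul_assoc matrix_mul_assoc)
      also have "\<dots> = blk11 G *v v + blk12 G *v W v + comb (Apart D) \<alpha> (\<mu> v)"
        unfolding XR
        by (simp add: hcat_mult_join transpose_rows_on_mult comb_def[symmetric] comb_uminus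
            matrix_vector_mult_uminus)
      finally show "G *v join v (W v) + comb D \<alpha> (\<mu> v) = join (Gamma_mat G D \<alpha> *v v) 0"
        using yeq[of v]
        by (simp add: blocks_mult[OF sym] comb_join join_add)
    qed
    show "row i D \<bullet> join v (W v) = 0" if "i \<in> \<alpha>" for v i
    proof -
      have "(P *v join (- W v) (- \<mu> v)) $ Inr i = (R *v v) $ Inr i"
        unfolding XR[symmetric] by (rule sol) (use that in auto)
      then show ?thesis unfolding P R using that by (simp add: inner_row_join)
    qed
  qed
qed

text \<open>Split \<open>Ginv *v comb D \<alpha> u\<close> into \<open>z' = join a (W a)\<close>,
  which is tangent to the constraints, and \<open>join 0 b\<close>. Orthogonality of
  \<open>z'\<close> to the normals turns the form into \<open>b \<bullet> (blk22 G *v b) - a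
  \<bullet> (Gamma_mat G D \<alpha> *v a)\<close>, which is negative unless \<open>a\<close> and
  \<open>b\<close> vanish.\<close>

lemma negdef_if_Gamma_posdef:
  fixes D :: "real^('x + 'y)^'m::finite"
  assumes indep: "indep_rows \<alpha> (Bpart D)" and pos: "posdef (Gamma_mat G D \<alpha>)"
  shows "negdef_on D \<alpha>"
  unfolding negdef_on_def
proof (intro allI impI, rule ccontr)
  fix u :: "real^'m" assume u: "\<exists>i\<in>\<alpha>. u $ i \<noteq> 0"
  assume *: "\<not> comb D \<alpha> u \<bullet> (Ginv *v comb D \<alpha> u) < 0"
  obtain W where W: "\<And>v. \<exists>\<mu>. G *v join v (W v) + comb D \<alpha> \<mu> = join (Gamma_mat G D \<alpha> *v v) 0"
    "\<And>v i. i \<in> \<alpha> \<Longrightarrow> row i D \<bullet> join v (W v) = 0"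
    using Gamma_solve[OF indep] by metis
  define z where "z = Ginv *v comb D \<alpha> u"
  define a where "a = xpart z"
  define z' where "z' = join a (W a)"
  define b where "b = ypart z - W a"
  have z: "z = z' + join 0 b" unfolding z'_def b_def a_def join_add by simp
  have Gz: "G *v z = comb D \<alpha> u" by (simp add: z_def)
  obtain \<mu> where \<mu>: "G *v z' + comb D \<alpha> \<mu> = join (Gamma_mat G D \<alpha> *v a) 0"
    unfolding z'_def using W(1) by blast
  have orth: "comb D \<alpha> v \<bullet> z' = 0" for v
    unfolding z'_def using W(2) by (rule inner_comb_eq_0)
  have 1: "a \<bullet> (Gamma_mat G D \<alpha> *v a) = z' \<bullet> (G *v z')"
    using arg_cong[OF \<mu>, of "\<lambda>q. z' \<bullet> q"] orth[of \<mu>] inner_commute[of z' "comb D \<alpha> \<mu>"]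
    by (simp add: inner_add_right z'_def inner_join)
  have "z' \<bullet> (G *v z) = 0" using orth[of u] by (simp add: Gz inner_commute)
  then have 2: "z' \<bullet> (G *v join 0 b) = - (z' \<bullet> (G *v z'))"
    by (simp add: z matrix_vector_right_distrib inner_add_right)
  have "comb D \<alpha> u \<bullet> (Ginv *v comb D \<alpha> u) = z \<bullet> (G *v z)"
    by (simp add: Gz z_def inner_commute)
  also have "\<dots> = z' \<bullet> (G *v z') + 2 * (z' \<bullet> (G *v join 0 b)) + join 0 b \<bullet> (G *v join 0 b)"
    using G_inner[of z' "join 0 b"]
    by (simp add: z matrix_vector_right_distrib inner_add_right inner_add_left inner_commute)
  also have "\<dots> = b \<bullet> (blk22 G *v b) - a \<bullet> (Gamma_mat G D \<alpha> *v a)"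
    unfolding 2 1 quadratic_form_join_0 by simp
  finally have le: "b \<bullet> (blk22 G *v b) - a \<bullet> (Gamma_mat G D \<alpha> *v a) \<ge> 0" using * by simp
  have "a = 0"
  proof (rule ccontr)
    assume "a \<noteq> 0"
    then have "0 < a \<bullet> (Gamma_mat G D \<alpha> *v a)" using pos by (simp add: posdef_def)
    then show False using le blk22_nonpos[of b] by simp
  qed
  moreover from this have "b = 0" using le blk22_neg[of b] by force
  \<comment> \<open>The pair \<open>join 0 (W 0)\<close> is tangent to the constraints and
    stationary, so pairing with it leaves only the form of \<open>blk22 G\<close>.\<close>
  moreover have "W 0 = 0"
  proof -
    obtain \<nu> where "G *v join 0 (W 0) + comb D \<alpha> \<nu> = join (Gamma_mat G D \<alpha> *v 0) 0"
      using W(1) by blast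
    from arg_cong[OF this, of "\<lambda>q. join 0 (W 0) \<bullet> q"]
    have "W 0 \<bullet> (blk22 G *v W 0) = 0"
      using inner_comb_eq_0[OF W(2)[of _ 0], of \<alpha> \<nu>] inner_commute[of "join 0 (W 0)" "comb D \<alpha> \<nu>"]
      by (simp add: inner_add_right quadratic_form_join_0)
    then show ?thesis using blk22_neg by force
  qed
  ultimately have "z = 0" by (simp add: z z'_def)
  then have "comb D \<alpha> u = 0" using Gz by simp
  then have "\<forall>i\<in>\<alpha>. u $ i = 0"
    using comb_indep[OF indep_rows_if_Bpart[OF indep]] by blast
  with u show False by blast
qed

text \<open>\<open>Gamma_mat\<close> is the form of \<open>G\<close> on the vectors
  \<open>join v (W v)\<close>. Such a vector is \<open>s - t\<close>, where \<open>G *v s\<close>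
  has zero y-part and \<open>G *v t\<close> is a combination of normals. Orthogonality gives the
  value \<open>s \<bullet> (G *v s) - t \<bullet> (G *v t)\<close>: a Schur term minus a nonpositive
  term.\<close>

lemma Gamma_posdef_if_negdef:
  fixes D :: "real^('x + 'y)^'m::finite"
  assumes nd: "negdef_on D \<alpha>"
  shows "posdef (Gamma_mat G D \<alpha>)"
proof -
  let ?\<Gamma> = "Gamma_mat G D \<alpha>"
  obtain W where W: "\<And>v. \<exists>\<mu>. G *v join v (W v) + comb D \<alpha> \<mu> = join (?\<Gamma> *v v) 0"
    "\<And>v i. i \<in> \<alpha> \<Longrightarrow> row i D \<bullet> join v (W v) = 0"
    using Gamma_solve[OF indep_rows_Bpart_if_negdef[OF nd]] by metis
  have orth: "comb D \<alpha> \<mu> \<bullet> join v (W v) = 0" for v \<mu>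
    by (rule inner_comb_eq_0) (rule W(2))
  have bil: "v' \<bullet> (?\<Gamma> *v v) = join v' (W v') \<bullet> (G *v join v (W v))" for v v'
  proof -
    obtain \<mu> where "G *v join v (W v) + comb D \<alpha> \<mu> = join (?\<Gamma> *v v) 0" using W(1) by blast
    from arg_cong[OF this, of "\<lambda>q. join v' (W v') \<bullet> q"] show ?thesis
      using orth[of \<mu> v'] inner_commute[of "join v' (W v')" "comb D \<alpha> \<mu>"]
      by (simp add: inner_add_right inner_join)
  qed
  have "transpose ?\<Gamma> = ?\<Gamma>"
  proof (rule symmetricI)
    fix a b show "a \<bullet> (?\<Gamma> *v b) = b \<bullet> (?\<Gamma> *v a)"
      using G_inner[of "join a (W a)" "join b (W b)"] by (simp add: bil inner_commute)
  qed
  moreover have "0 < v \<bullet> (?\<Gamma> *v v)" if "v \<noteq> 0" for v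
  proof -
    define z where "z = join v (W v)"
    obtain \<mu> where \<mu>: "G *v z + comb D \<alpha> \<mu> = join (?\<Gamma> *v v) 0"
      unfolding z_def using W(1) by blast
    define e where "e = join (?\<Gamma> *v v) (0 :: real^'y)"
    define s t where "s = Ginv *v e" and "t = Ginv *v comb D \<alpha> \<mu>"
    have "G *v z = e - comb D \<alpha> \<mu>" using \<mu> by (simp add: e_def eq_diff_eq)
    then have "Ginv *v (G *v z) = Ginv *v (e - comb D \<alpha> \<mu>)" by (rule arg_cong)
    then have zst: "z = s - t" by (simp add: s_def t_def matrix_vector_mult_diff_distrib)
    have "z \<bullet> (G *v t) = 0" using orth[of \<mu> v] by (simp add: t_def z_def inner_commute)
    then have st: "s \<bullet> (G *v t) = t \<bullet> (G *v t)" by (simp add: zst inner_diff_left)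
    have ts: "t \<bullet> (G *v s) = s \<bullet> (G *v t)" using G_inner[of t s] by (simp add: inner_commute)
    have "v \<bullet> (?\<Gamma> *v v) = s \<bullet> (G *v s) - t \<bullet> (G *v t)"
      unfolding bil z_def[symmetric] zst
      by (simp add: matrix_vector_mult_diff_distrib inner_diff_left inner_diff_right st ts)
    moreover have "s \<bullet> (G *v s) = xpart s \<bullet> (Schur *v xpart s)"
      by (rule quadratic_form_eq) (simp add: s_def e_def)
    moreover have tt: "t \<bullet> (G *v t) = comb D \<alpha> \<mu> \<bullet> (Ginv *v comb D \<alpha> \<mu>)"
      by (simp add: t_def inner_commute)
    \<comment> \<open>Strictness: either the multipliers do not vanish on \<alpha>, or
      \<open>t = 0\<close> and the x-part of \<open>s\<close> is the nonzero
      \<open>v\<close>.\<close>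
    moreover have "0 < xpart s \<bullet> (Schur *v xpart s) \<or> t \<bullet> (G *v t) < 0"
    proof (cases "\<exists>i\<in>\<alpha>. \<mu> $ i \<noteq> 0")
      case True
      then show ?thesis using nd unfolding tt negdef_on_def by blast
    next
      case False
      then have "t = 0" by (simp add: t_def comb_eq_0)
      then have "s = join v (W v)" using zst by (simp add: z_def)
      then have "xpart s = v" by simp
      then show ?thesis using Schur_pos[OF that] by simp
    qed
    ultimately show ?thesis
      using Schur_nonneg[of "xpart s"] negdef_on_le[OF nd, of \<mu>] by linarith
  qed
  ultimately show ?thesis by (simp add: posdef_def)
qed

end

section \<open>Local minimax points\<close>

lemma slack_add: "slack D h i (z + e) = slack D h i z + row i D \<bullet> e"
  by (simp add: slack_def inner_add_right)

lemma continuous_on_join: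
  fixes x :: "real^'x::finite" and S :: "(real^'y::finite) set"
  shows "continuous_on S (\<lambda>\<omega>. join x \<omega>)"
  unfolding join_def
proof (rule continuous_on_vec_lambda)
  fix k :: "'x + 'y"
  show "continuous_on S (\<lambda>\<omega>. case k of Inl a \<Rightarrow> x $ a | Inr b \<Rightarrow> \<omega> $ b)"
    by (cases k) (auto intro!: continuous_intros)
qed

lemma continuous_on_objective: "continuous_on S (\<lambda>\<omega>. objective G c (join x \<omega>))"
  unfolding objective_def
  by (intro continuous_intros continuous_on_join
      linear_continuous_on_compose[OF continuous_on_join matrix_vector_mul_linear])

lemma closed_Yset: "closed (Yset D h J x)"
proof -
  have "Yset D h J x = (\<Inter>i\<in>J. {y. slack D h i (join x y) \<le> 0})"
    by (auto simp: Yset_def)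
  moreover have "closed {y. slack D h i (join x y) \<le> 0}" for i
    unfolding slack_def by (intro closed_Collect_le continuous_intros continuous_on_join)
  ultimately show ?thesis by auto
qed

section \<open>Optimality conditions, and changes of the active set\<close>

context saddle_matrix begin

lemma objective_add:
  "objective G c (z + e) = objective G c z + grad G c z \<bullet> e + (1/2) * (e \<bullet> (G *v e))"
  using G_inner[of z e]
  by (simp add: objective_def grad_def matrix_vector_right_distrib inner_add_left inner_add_right
      inner_commute algebra_simps)

lemma grad_inner:
  assumes "G *v z + c + comb D \<alpha> u = 0"
  shows "grad G c z \<bullet> e = - (\<Sum>i\<in>\<alpha>. u $ i * (row i D \<bullet> e))"
proof -
  have "grad G c z = - comb D \<alpha> u"
    using assms by (simp add: grad_def eq_neg_iff_add_eq_0)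
  then show ?thesis by (simp add: inner_comb)
qed

text \<open>Concavity in y and the signs of the multipliers give maximality over all of
  \<open>Yset\<close>. For a nearby \<open>x\<close>, shifting y by \<open>W v\<close> keeps
  \<alpha> active and changes the objective by half of the nonnegative form of
  \<open>Gamma_mat\<close> at \<open>v\<close>.\<close>

lemma local_minimaxI:
  fixes D :: "real^('x + 'y)^'m::finite"
  assumes nd: "negdef_on D \<alpha>" and kkt: "G *v z + c + comb D \<alpha> u = 0"
    and active: "\<And>i. i \<in> \<alpha> \<Longrightarrow> slack D h i z = 0" and u: "\<And>i. i \<in> \<alpha> \<Longrightarrow> u $ i \<le> 0"
  shows "local_minimax G c D h \<alpha> z"
proof -
  obtain W where W: "linear W"
    "\<And>v. \<exists>\<mu>. G *v join v (W v) + comb D \<alpha> \<mu> = join (Gamma_mat G D \<alpha> *v v) 0"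
    "\<And>v i. i \<in> \<alpha> \<Longrightarrow> row i D \<bullet> join v (W v) = 0"
    using Gamma_solve[OF indep_rows_Bpart_if_negdef[OF nd]] by metis
  obtain B where B: "B > 0" "\<And>v. norm (W v) \<le> B * norm v"
    using linear_bounded_pos[OF W(1)] by metis
  have upper: "objective G c (join (xpart z) y) \<le> objective G c z"
    if y: "y \<in> Yset D h \<alpha> (xpart z)" for y
  proof -
    define e where "e = join (0 :: real^'x) (y - ypart z)"
    have ze: "join (xpart z) y = z + e"
      using join_add[of "xpart z" "ypart z" 0 "y - ypart z"] by (simp add: e_def)
    have "u $ i * (row i D \<bullet> e) \<ge> 0" if "i \<in> \<alpha>" for i
    proof -
      have "row i D \<bullet> e \<le> 0"
        using y that active[OF that] by (auto simp: Yset_def ze slack_add)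
      then show ?thesis using u[OF that] by (rule mult_nonpos_nonpos[rotated])
    qed
    then have "grad G c z \<bullet> e \<le> 0" by (simp add: grad_inner[OF kkt] sum_nonneg)
    moreover have "e \<bullet> (G *v e) \<le> 0"
      unfolding e_def quadratic_form_join_0 by (rule blk22_nonpos)
    ultimately show ?thesis unfolding ze objective_add by simp
  qed
  have lower: "\<exists>\<omega>\<in>Yset D h \<alpha> x \<inter> cball (ypart z) (B * \<delta>). objective G c z \<le> objective G c (join x \<omega>)"
    if x: "x \<in> cball (xpart z) \<delta>" for x \<delta>
  proof
    define v where "v = x - xpart z"
    define e where "e = join v (W v)"
    have ze: "join x (ypart z + W v) = z + e"
      using join_add[of "xpart z" "ypart z" v "W v"] by (simp add: e_def v_def)
    have 0: "row i D \<bullet> e = 0" if "i \<in> \<alpha>" for i unfolding e_def by (rule W(3)[OF that])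
    then have "grad G c z \<bullet> e = 0" by (simp add: grad_inner[OF kkt])
    moreover have "e \<bullet> (G *v e) \<ge> 0"
    proof -
      obtain \<mu> where \<mu>: "G *v e + comb D \<alpha> \<mu> = join (Gamma_mat G D \<alpha> *v v) 0"
        unfolding e_def using W(2) by blast
      have "e \<bullet> (G *v e) = v \<bullet> (Gamma_mat G D \<alpha> *v v)"
        using arg_cong[OF \<mu>, of "\<lambda>q. e \<bullet> q"] inner_comb_eq_0[OF 0, of \<alpha> \<mu>]
          inner_commute[of e "comb D \<alpha> \<mu>"]
        by (simp add: inner_add_right e_def inner_join)
      then show ?thesis
        using Gamma_posdef_if_negdef[OF nd] by (cases "v = 0") (auto simp: posdef_def less_imp_le)
    qed
    ultimately show "objective G c z \<le> objective G c (join x (ypart z + W v))"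
      unfolding ze objective_add by simp
    have "norm v \<le> \<delta>" using x by (simp add: v_def dist_norm norm_minus_commute)
    then have "norm (W v) \<le> B * \<delta>"
      using B by (meson mult_left_mono order_trans less_imp_le)
    then show "ypart z + W v \<in> Yset D h \<alpha> x \<inter> cball (ypart z) (B * \<delta>)"
      using 0 active by (simp add: Yset_def ze slack_add dist_norm)
  qed
  \<comment> \<open>The definition asks for an attained maximum; compactness provides it once the
    point from \<open>lower\<close> shows that the set is nonempty.\<close>
  have "\<exists>v. v \<in> (\<lambda>\<omega>. objective G c (join x \<omega>)) ` (Yset D h \<alpha> x \<inter> cball (ypart z) (B * \<delta>)) \<and>
      (\<forall>w\<in>(\<lambda>\<omega>. objective G c (join x \<omega>)) ` (Yset D h \<alpha> x \<inter> cball (ypart z) (B * \<delta>)). w \<le> v) \<and>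
      objective G c z \<le> v"
    if x: "x \<in> cball (xpart z) \<delta>" for x \<delta>
  proof -
    let ?Y = "Yset D h \<alpha> x \<inter> cball (ypart z) (B * \<delta>)"
    have "compact ?Y" by (simp add: closed_Int_compact closed_Yset)
    moreover have "?Y \<noteq> {}" using lower[OF x] by blast
    ultimately obtain \<omega> where \<omega>: "\<omega> \<in> ?Y"
      "\<forall>y\<in>?Y. objective G c (join x y) \<le> objective G c (join x \<omega>)"
      using continuous_attains_sup[OF _ _ continuous_on_objective, of ?Y G c x] by blast
    from lower[OF x] obtain \<omega>' where \<omega>':
      "\<omega>' \<in> ?Y" "objective G c z \<le> objective G c (join x \<omega>')" by blast
    have "objective G c z \<le> objective G c (join x \<omega>)"
      using order_trans[OF \<omega>'(2) \<omega>(2)[rule_format, OF \<omega>'(1)]] .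
    with \<omega> show ?thesis by (intro exI[of _ "objective G c (join x \<omega>)"]) auto
  qed
  moreover have "((\<lambda>\<delta>. B * \<delta>) \<longlongrightarrow> 0) (at_right 0)"
    by (auto intro!: tendsto_eq_intros)
  moreover have "ypart z \<in> Yset D h \<alpha> (xpart z)" using active by (simp add: Yset_def)
  ultimately show ?thesis
    \<comment> \<open>The bound \<open>B\<close> on \<open>W\<close> yields the radius
      \<open>B * \<delta>\<close>. The estimates hold for every \<delta>, so 1 is an arbitrary
      choice of \<open>\<delta>0\<close>.\<close>
    unfolding local_minimax_def using B(1) upper
    by (intro conjI exI[of _ "1::real"] exI[of _ "\<lambda>\<delta>. B * \<delta>"]) auto
qed

lemma S_pairI:
  fixes D :: "real^('x + 'y)^'m::finite"
  assumes nd: "negdef_on D \<alpha>" and kkt: "G *v z + c + comb D \<alpha> u = 0"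
    and active: "\<And>i. i \<in> \<alpha> \<Longrightarrow> slack D h i z = 0" and u: "\<And>i. i \<in> \<alpha> \<Longrightarrow> u $ i \<le> 0"
  shows "S_pair G c D h z \<alpha>"
proof -
  have "\<exists>l. (\<forall>i\<in>\<alpha>. l i \<le> 0) \<and> G *v z + c + (\<Sum>i\<in>\<alpha>. l i *\<^sub>R row i D) = 0"
    using kkt u by (intro exI[of _ "\<lambda>i. u $ i"]) (simp add: comb_def)
  then show ?thesis
    unfolding S_pair_def
    using local_minimaxI[OF assms] active indep_rows_Bpart_if_negdef[OF nd]
      indep_rows_if_Bpart[OF indep_rows_Bpart_if_negdef[OF nd]] Gamma_posdef_if_negdef[OF nd]
    by blast
qed

text \<open>A Schur complement argument: writing \<open>row p D\<close> as \<open>G *v d\<close>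
  minus a combination of active normals splits the form into the one on \<alpha> and the square of
  \<open>u $ p\<close> times the negative number \<open>row p D \<bullet> d\<close>.\<close>

lemma negdef_on_insert:
  fixes D :: "real^('x + 'y)^'m::finite"
  assumes nd: "negdef_on D \<alpha>" and p: "p \<notin> \<alpha>" and neg: "row p D \<bullet> step_d G D p \<alpha> < 0"
  shows "negdef_on D (insert p \<alpha>)"
  unfolding negdef_on_def
proof (intro allI impI)
  fix u :: "real^'m" assume u: "\<exists>i\<in>insert p \<alpha>. u $ i \<noteq> 0"
  define d where "d = step_d G D p \<alpha>"
  define w where "w = u - u $ p *\<^sub>R step_r G D p \<alpha>"
  define q where "q = comb D \<alpha> w"
  have "comb D (insert p \<alpha>) u = q + u $ p *\<^sub>R (G *v d)"
    by (simp add: comb_insert p q_def w_def comb_diff comb_scaleR d_def G_step_d[OF nd] scaleR_right_distrib)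
  moreover have "q \<bullet> d = 0"
    unfolding q_def d_def by (rule inner_comb_eq_0) (rule row_step_d[OF nd])
  moreover have "(G *v d) \<bullet> (Ginv *v q) = d \<bullet> q"
    using G_inner[of d "Ginv *v q"] by simp
  moreover have "(G *v d) \<bullet> d = row p D \<bullet> d"
    using step_d_quadratic[OF nd, of p] by (simp add: d_def inner_commute)
  ultimately have eq: "comb D (insert p \<alpha>) u \<bullet> (Ginv *v comb D (insert p \<alpha>) u)
      = q \<bullet> (Ginv *v q) + (u $ p)\<^sup>2 * (row p D \<bullet> d)"
    by (simp add: matrix_vector_right_distrib matrix_vector_mult_scaleR inner_add_left inner_add_right
        inner_commute[of d q] power2_eq_square)
  show "comb D (insert p \<alpha>) u \<bullet> (Ginv *v comb D (insert p \<alpha>) u) < 0"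
  proof (cases "u $ p = 0")
    case True
    then have "\<exists>i\<in>\<alpha>. u $ i \<noteq> 0" using u by auto
    then have "q \<bullet> (Ginv *v q) < 0"
      using nd True by (simp add: q_def w_def negdef_on_def)
    then show ?thesis using eq True by simp
  next
    case False
    have "q \<bullet> (Ginv *v q) \<le> 0" unfolding q_def by (rule negdef_on_le[OF nd])
    moreover have "(u $ p)\<^sup>2 * (row p D \<bullet> d) < 0"
      using False neg by (simp add: d_def mult_pos_neg)
    ultimately show ?thesis using eq by simp
  qed
qed

text \<open>\<open>G *v (d - d')\<close> is a combination of normals in \<beta>, so the form of
  \<open>G\<close> at \<open>d - d'\<close> is nonpositive. The KKT systems of the two directions
  evaluate it as the difference of the two sides.\<close>

lemma step_d_mono:
  fixes D :: "real^('x + 'y)^'m::finite"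
  assumes nd: "negdef_on D \<beta>" and sub: "\<alpha> \<subseteq> \<beta>"
  shows "row p D \<bullet> step_d G D p \<alpha> \<le> row p D \<bullet> step_d G D p \<beta>"
proof -
  note nda = negdef_on_subset[OF nd sub]
  define d r where "d = step_d G D p \<beta>" and "r = step_r G D p \<beta>"
  define d' r' where "d' = step_d G D p \<alpha>" and "r' = step_r G D p \<alpha>"
  have Gd': "G *v d' = row p D + comb D \<beta> r'"
    unfolding d'_def G_step_d[OF nda] r'_def
    using step_r_supported[OF nda, of p] by (subst comb_mono[OF sub]) (auto simp: supported_on_def)
  have "d \<bullet> comb D \<beta> r' = 0"
    using inner_comb_eq_0[OF row_step_d[OF nd], of \<beta> r' p] by (simp add: d_def inner_commute)
  then have dd': "d \<bullet> (G *v d') = row p D \<bullet> d"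
    by (simp add: Gd' inner_add_right inner_commute)
  have "G *v (d - d') = comb D \<beta> (r - r')"
    unfolding matrix_vector_mult_diff_distrib Gd' comb_diff
    by (simp add: d_def r_def G_step_d[OF nd])
  then have "(d - d') \<bullet> (G *v (d - d')) \<le> 0"
    using negdef_on_le[OF nd, of "r - r'"] G_Ginv(2)[of "d - d'"] by (simp add: inner_commute)
  moreover have "(d - d') \<bullet> (G *v (d - d')) = row p D \<bullet> d' - row p D \<bullet> d"
    using step_d_quadratic[OF nd, of p] step_d_quadratic[OF nda, of p] dd' G_inner[of d d']
    by (simp add: d_def[symmetric] d'_def[symmetric] matrix_vector_mult_diff_distrib inner_diff_left
        inner_diff_right inner_commute)
  ultimately show ?thesis by (simp add: d_def d'_def)
qed

lemma local_minimax_KKT: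
  fixes D :: "real^('x + 'y)^'m::finite"
  assumes lm: "local_minimax G c D h J w"
  obtains u where "\<And>i. u $ i \<le> 0" "G *v w + c + comb D J u = 0" "\<And>i. i \<in> J \<Longrightarrow> slack D h i w \<le> 0"
proof -
  from lm have feas: "ypart w \<in> Yset D h J (xpart w)" by (simp add: local_minimax_def)
  from lm obtain \<delta>0 \<eta> where \<delta>0: "\<delta>0 > 0" and all:
    "\<forall>\<delta>\<in>{0<..\<delta>0}. \<forall>x\<in>cball (xpart w) \<delta>. \<forall>y\<in>Yset D h J (xpart w) \<inter> cball (ypart w) \<delta>.
       objective G c (join (xpart w) y) \<le> objective G c w \<and>
       (\<exists>v. v \<in> (\<lambda>\<omega>. objective G c (join x \<omega>)) ` (Yset D h J x \<inter> cball (ypart w) (\<eta> \<delta>)) \<and>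
            (\<forall>w'\<in>(\<lambda>\<omega>. objective G c (join x \<omega>)) ` (Yset D h J x \<inter> cball (ypart w) (\<eta> \<delta>)). w' \<le> v) \<and>
            objective G c w \<le> v)"
    unfolding local_minimax_def by blast
  have ymax: "objective G c (join (xpart w) y) \<le> objective G c w"
    if "y \<in> Yset D h J (xpart w)" "y \<in> cball (ypart w) \<delta>0" for y
    using all[THEN bspec[of _ _ \<delta>0], THEN bspec[of _ _ "xpart w"], THEN bspec[of _ _ y]] that \<delta>0
    by auto
  have xmin: "\<exists>\<omega>\<in>Yset D h J x. objective G c w \<le> objective G c (join x \<omega>)"
    if "x \<in> cball (xpart w) \<delta>0" for x
    using all[THEN bspec[of _ _ \<delta>0], THEN bspec[of _ _ x], THEN bspec[of _ _ "ypart w"]] that \<delta>0 feas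
    by auto
  have slack_le: "slack D h i w \<le> 0" if "i \<in> J" for i
    using feas that by (simp add: Yset_def)
  define \<beta> where "\<beta> = {i\<in>J. slack D h i w = 0}"
  define g where "g = grad G c w"
  \<comment> \<open>A short move of y along \<open>e\<close> stays feasible: active constraints by
    the choice of \<open>e\<close>, inactive ones by continuity. Dividing the change of the
    objective by \<open>t\<close> and letting \<open>t\<close> tend to 0 leaves the linear
    term.\<close>
  have first: "ypart g \<bullet> e \<le> 0" if e: "\<And>i. i \<in> \<beta> \<Longrightarrow> row i (Bpart D) \<bullet> e \<le> 0" for e
  proof -
    have wt: "join (xpart w) (ypart w + t *\<^sub>R e) = w + t *\<^sub>R join 0 e" for t
      using join_add[of "xpart w" "ypart w" 0 "t *\<^sub>R e"] by (simp add: join_scaleR)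
    have "\<forall>\<^sub>F t in at_right (0::real). slack D h i (w + t *\<^sub>R join 0 e) \<le> 0" if "i \<in> J" for i
    proof (cases "i \<in> \<beta>")
      case True
      have "slack D h i (w + t *\<^sub>R join 0 e) \<le> 0" if "t > 0" for t
        using True e[OF True] that
        by (simp add: slack_add \<beta>_def inner_row_join mult_nonneg_nonpos)
      then show ?thesis by (auto simp: eventually_at_filter)
    next
      case False
      then have neg: "slack D h i w < 0" using slack_le[OF that] that by (auto simp: \<beta>_def)
      have "((\<lambda>t. slack D h i w + t * (row i D \<bullet> join 0 e)) \<longlongrightarrow> slack D h i w) (at_right (0::real))"
        by (auto intro!: tendsto_eq_intros)
      from order_tendstoD(2)[OF this neg] show ?thesis
        by (rule eventually_mono) (simp add: slack_add)
    qed
    then have ev1: "\<forall>\<^sub>F t in at_right (0::real). \<forall>i\<in>J. slack D h i (w + t *\<^sub>R join 0 e) \<le> 0"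
      by (simp add: eventually_ball_finite)
    have "((\<lambda>t. norm (t *\<^sub>R e)) \<longlongrightarrow> 0) (at_right (0::real))"
      by (auto intro!: tendsto_eq_intros)
    then have ev2: "\<forall>\<^sub>F t in at_right (0::real). norm (t *\<^sub>R e) < \<delta>0"
      using order_tendstoD(2) \<delta>0 by blast
    have "\<forall>\<^sub>F t in at_right (0::real). ypart g \<bullet> e + t * (1/2) * (e \<bullet> (blk22 G *v e)) \<le> 0"
      using ev1 ev2 eventually_at_right_less[of "0::real"]
    proof eventually_elim
      case (elim t)
      have "objective G c (join (xpart w) (ypart w + t *\<^sub>R e)) \<le> objective G c w"
        by (rule ymax) (use elim in \<open>auto simp: Yset_def wt dist_norm\<close>)
      then have "t * (g \<bullet> join 0 e) + (1/2) * (t * (t * (join 0 e \<bullet> (G *v join 0 e)))) \<le> 0"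
        by (simp add: wt objective_add g_def matrix_vector_mult_scaleR)
      then have "t * (ypart g \<bullet> e + t * (1/2) * (e \<bullet> (blk22 G *v e))) \<le> 0"
        by (simp add: quadratic_form_join_0 inner_parts[of g] algebra_simps)
      then show ?case using elim(3) by (simp add: mult_le_0_iff)
    qed
    moreover have "((\<lambda>t. ypart g \<bullet> e + t * (1/2) * (e \<bullet> (blk22 G *v e))) \<longlongrightarrow> ypart g \<bullet> e) (at_right (0::real))"
      by (auto intro!: tendsto_eq_intros)
    ultimately show ?thesis by (auto intro: tendsto_upperbound)
  qed
  obtain \<mu> where \<mu>: "supported_on \<beta> \<mu>" "\<And>i. 0 \<le> \<mu> $ i" "ypart g = comb (Bpart D) \<beta> \<mu>"
    using farkas[OF first] by blast
  define u where "u = - \<mu>"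
  have u: "u $ i \<le> 0" for i using \<mu>(2) by (simp add: u_def)
  have combJ: "comb D J u = comb D \<beta> u"
    by (rule comb_mono) (use \<mu>(1) in \<open>auto simp: u_def supported_on_def \<beta>_def\<close>)
  \<comment> \<open>The x-gradient of the Lagrangian at \<open>w\<close>; its y-gradient vanishes by
    the choice of \<open>u\<close>.\<close>
  define \<xi> where "\<xi> = xpart (g + comb D \<beta> u)"
  have L: "g + comb D \<beta> u = join \<xi> 0"
    by (rule trans[OF join_parts[symmetric]]) (simp add: \<xi>_def comb_parts u_def comb_uminus \<mu>(3))
  \<comment> \<open>On feasible points the multiplier term is nonnegative, so the Lagrangian bounds
    the objective from above. Its quadratic part is at most the Schur form of \<open>v\<close>,
    whatever \<omega> is.\<close>
  have key: "0 \<le> \<xi> \<bullet> v + (1/2) * (v \<bullet> (Schur *v v))" if v: "norm v \<le> \<delta>0" for v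
  proof -
    have "xpart w + v \<in> cball (xpart w) \<delta>0" using v by (simp add: dist_norm)
    from xmin[OF this] obtain \<omega> where \<omega>: "\<omega> \<in> Yset D h J (xpart w + v)"
      "objective G c w \<le> objective G c (join (xpart w + v) \<omega>)" by blast
    define e where "e = join v (\<omega> - ypart w)"
    have we: "join (xpart w + v) \<omega> = w + e"
      using join_add[of "xpart w" "ypart w" v "\<omega> - ypart w"] by (simp add: e_def)
    have "u $ i * (row i D \<bullet> e) \<ge> 0" if "i \<in> \<beta>" for i
    proof -
      have "row i D \<bullet> e \<le> 0"
        using \<omega>(1) that by (force simp: Yset_def we slack_add \<beta>_def)
      then show ?thesis using u by (simp add: mult_nonpos_nonpos)
    qed
    then have "comb D \<beta> u \<bullet> e \<ge> 0" by (simp add: inner_comb sum_nonneg)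
    moreover have "g \<bullet> e + comb D \<beta> u \<bullet> e = \<xi> \<bullet> v"
      using arg_cong[OF L, of "\<lambda>q. q \<bullet> e"] by (simp add: inner_add_left e_def inner_join)
    moreover have "0 \<le> g \<bullet> e + (1/2) * (e \<bullet> (G *v e))"
      using \<omega>(2) by (simp add: we objective_add g_def)
    moreover have "e \<bullet> (G *v e) \<le> v \<bullet> (Schur *v v)"
      using quadratic_form_le[of e] by (simp add: e_def)
    ultimately show ?thesis by linarith
  qed
  \<comment> \<open>Testing \<open>key\<close> with \<open>- (t *\<^sub>R \<xi>)\<close> and
    dividing by \<open>t\<close> bounds the squared norm of \<xi> by a quantity that tends to
    0.\<close>
  have "((\<lambda>t. norm (t *\<^sub>R \<xi>)) \<longlongrightarrow> 0) (at_right (0::real))"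
    by (auto intro!: tendsto_eq_intros)
  then have "\<forall>\<^sub>F t in at_right (0::real). norm (t *\<^sub>R \<xi>) < \<delta>0"
    using order_tendstoD(2) \<delta>0 by blast
  then have "\<forall>\<^sub>F t in at_right (0::real). \<xi> \<bullet> \<xi> \<le> t * (1/2) * (\<xi> \<bullet> (Schur *v \<xi>))"
    using eventually_at_right_less[of "0::real"]
  proof eventually_elim
    case (elim t)
    have "0 \<le> - (t * (\<xi> \<bullet> \<xi>)) + (1/2) * (t * (t * (\<xi> \<bullet> (Schur *v \<xi>))))"
      using key[of "- (t *\<^sub>R \<xi>)"] elim(1) by (simp add: matrix_vector_mult_uminus matrix_vector_mult_scaleR)
    then have "t * (\<xi> \<bullet> \<xi>) \<le> t * (t * (1/2) * (\<xi> \<bullet> (Schur *v \<xi>)))" by (simp add: algebra_simps)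
    then show ?case using elim(2) by simp
  qed
  moreover have "((\<lambda>t. t * (1/2) * (\<xi> \<bullet> (Schur *v \<xi>))) \<longlongrightarrow> 0) (at_right (0::real))"
    by (auto intro!: tendsto_eq_intros)
  ultimately have "\<xi> \<bullet> \<xi> \<le> 0" by (auto intro: tendsto_lowerbound)
  then have "\<xi> = 0" by (metis inner_gt_zero_iff not_le)
  then have "G *v w + c + comb D J u = 0" using L by (simp add: combJ g_def grad_def)
  then show thesis using that u slack_le by blast
qed

lemma no_local_minimax:
  fixes D :: "real^('x + 'y)^'m::finite"
  assumes nd: "negdef_on D \<alpha>" and p: "p \<notin> \<alpha>"
    and r: "\<And>i. i \<in> \<alpha> \<Longrightarrow> step_r G D p \<alpha> $ i \<ge> 0"
    and curv: "row p D \<bullet> step_d G D p \<alpha> \<ge> 0"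
    and kkt: "G *v z + c + comb D (insert p \<alpha>) u = 0"
    and active: "\<And>i. i \<in> \<alpha> \<Longrightarrow> slack D h i z = 0"
    and pos: "slack D h p z + u $ p * (row p D \<bullet> step_d G D p \<alpha>) > 0"
  shows "\<not> local_minimax G c D h (insert p \<alpha>) w"
proof
  assume "local_minimax G c D h (insert p \<alpha>) w"
  then obtain v where v: "\<And>i. v $ i \<le> 0" "G *v w + c + comb D (insert p \<alpha>) v = 0"
    "\<And>i. i \<in> insert p \<alpha> \<Longrightarrow> slack D h i w \<le> 0"
    using local_minimax_KKT by blast
  define d r where "d = step_d G D p \<alpha>" and "r = step_r G D p \<alpha>"
  define k where "k = row p D \<bullet> d"
  \<comment> \<open>Pairing a KKT equation with \<open>d\<close> removes the multipliers of \<alpha>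
    and keeps only that of \<open>p\<close>.\<close>
  have proj: "d \<bullet> (G *v z') + d \<bullet> c + u' $ p * k = 0"
    if "G *v z' + c + comb D (insert p \<alpha>) u' = 0" for z' u'
  proof -
    have "comb D \<alpha> u' \<bullet> d = 0"
      unfolding d_def by (rule inner_comb_eq_0) (rule row_step_d[OF nd])
    then show ?thesis
      using arg_cong[OF that, of "\<lambda>q. q \<bullet> d"]
      by (simp add: comb_insert[OF p] inner_add_left inner_add_right k_def inner_commute)
  qed
  have "d \<bullet> (G *v w) - d \<bullet> (G *v z) = (row p D + comb D \<alpha> r) \<bullet> (w - z)"
    unfolding r_def G_step_d[OF nd, symmetric] d_def[symmetric] G_inner
    by (simp add: matrix_vector_mult_diff_distrib inner_diff_right)
  also have "\<dots> = slack D h p w - slack D h p z + (\<Sum>i\<in>\<alpha>. r $ i * slack D h i w)"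
  proof -
    have "row i D \<bullet> (w - z) = slack D h i w" if "i \<in> \<alpha>" for i
      using active[OF that] by (simp add: slack_def inner_diff_right)
    then have "comb D \<alpha> r \<bullet> (w - z) = (\<Sum>i\<in>\<alpha>. r $ i * slack D h i w)"
      by (simp add: inner_comb)
    moreover have "row p D \<bullet> (w - z) = slack D h p w - slack D h p z"
      by (simp add: slack_def inner_diff_right)
    ultimately show ?thesis by (simp only: inner_add_left)
  qed
  finally have "slack D h p z + u $ p * k = slack D h p w + (\<Sum>i\<in>\<alpha>. r $ i * slack D h i w) + v $ p * k"
    using proj[OF kkt] proj[OF v(2)] by linarith
  moreover have "(\<Sum>i\<in>\<alpha>. r $ i * slack D h i w) \<le> 0"
    by (rule sum_nonpos) (use r v(3) in \<open>simp add: r_def mult_nonneg_nonpos\<close>)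
  moreover have "v $ p * k \<le> 0"
    using curv v(1) by (simp add: k_def d_def mult_nonpos_nonneg)
  ultimately show False using pos v(3)[of p] by (simp add: k_def d_def)
qed

end

section \<open>The step procedure\<close>

lemma step_t1_lower:
  "j \<in> \<alpha> \<Longrightarrow> step_r G D p \<alpha> $ j < 0 \<Longrightarrow> step_t1 G D p (z, \<alpha>, u) \<le> ereal (u $ j / step_r G D p \<alpha> $ j)"
  by (auto intro: INF_lower)

text \<open>The infimum over a finite nonempty set is attained, and over the empty set it would be
  \<infinity>.\<close>

lemma t1_attaining_nonempty:
  assumes "step_t1 G D p (z, \<alpha>, u) \<noteq> \<infinity>"
  shows "t1_attaining G D p (z, \<alpha>, u) \<noteq> {}"
proof -
  let ?A = "{j\<in>\<alpha>. step_r G D p \<alpha> $ j < 0}"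
  let ?f = "\<lambda>j. ereal (u $ j / step_r G D p \<alpha> $ j)"
  have "?A \<noteq> {}"
  proof
    assume A: "?A = {}"
    have "step_t1 G D p (z, \<alpha>, u) = \<infinity>"
      unfolding step_t1.simps A by (simp add: top_ereal_def)
    with assms show False by simp
  qed
  then have "Inf (?f ` ?A) \<in> ?f ` ?A"
    using Min_in[of "?f ` ?A"] by (simp add: Min_Inf)
  then obtain j where "j \<in> ?A" "Inf (?f ` ?A) = ?f j" by auto
  then have "j \<in> t1_attaining G D p (z, \<alpha>, u)" by simp
  then show ?thesis by blast
qed

context saddle_matrix begin

text \<open>\<open>b\<close> is the objective value at the start. The last clause bounds the
  Lagrangian, not the objective, and the clause before it is the positivity that excludes a local
  minimax point when the procedure stops.\<close>

fun step_invariant :: "real^('x + 'y) \<Rightarrow> real^('x + 'y)^'m::finite \<Rightarrow> real^'m \<Rightarrow> 'm \<Rightarrow> real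
    \<Rightarrow> ('x, 'y, 'm) state \<Rightarrow> bool" where
  "step_invariant c D h p b (z, \<alpha>, u) \<longleftrightarrow>
     negdef_on D \<alpha> \<and> p \<notin> \<alpha> \<and> (\<forall>i. u $ i \<le> 0) \<and> G *v z + c + comb D (insert p \<alpha>) u = 0 \<and>
     (\<forall>i\<in>\<alpha>. slack D h i z = 0) \<and> slack D h p z > 0 \<and>
     slack D h p z + u $ p * (row p D \<bullet> step_d G D p \<alpha>) > 0 \<and>
     objective G c z + u $ p * slack D h p z \<le> b"

text \<open>Both quotients divide nonpositive numbers by negative ones. Nonnegativity also excludes
  \<open>-\<infinity>\<close>, so a step length other than \<infinity> is real.\<close>

lemma step_t_nonneg:
  fixes D :: "real^('x + 'y)^'m::finite"
  assumes inv: "step_invariant c D h p b (z, \<alpha>, u)" and fin: "step_t G D h p (z, \<alpha>, u) \<noteq> \<infinity>"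
  obtains t where "t \<ge> 0" "step_t G D h p (z, \<alpha>, u) = ereal t"
proof -
  have "0 \<le> step_t1 G D p (z, \<alpha>, u)"
    using inv by (auto intro!: INF_greatest divide_nonpos_nonpos)
  moreover have "0 \<le> step_t2 G D h p (z, \<alpha>, u)"
    using inv by (auto intro: divide_nonneg_neg simp: divide_nonneg_neg)
  ultimately have "0 \<le> step_t G D h p (z, \<alpha>, u)" by (simp add: step_t_def)
  with fin that show thesis by (cases "step_t G D h p (z, \<alpha>, u)") auto
qed

text \<open>The moves of z and u cancel in the KKT equation by \<open>G_step_d\<close>. The slack of
  \<open>p\<close> grows by \<open>t\<close> times the curvature while \<open>u $ p\<close> drops by
  \<open>t\<close>, so their combination in the invariant is constant. The Lagrangian falls by
  \<open>t\<close> times the mean of the old and new slack.\<close>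

lemma step_facts:
  fixes D :: "real^('x + 'y)^'m::finite"
  assumes inv: "step_invariant c D h p b (z, \<alpha>, u)"
    and t: "step_t G D h p (z, \<alpha>, u) = ereal t" "t \<ge> 0"
  defines "z' \<equiv> step_z G D h p (z, \<alpha>, u)" and "u' \<equiv> step_u G D h p (z, \<alpha>, u)"
  shows "u' $ i \<le> 0"
    and "i \<in> \<alpha> \<Longrightarrow> u' $ i = u $ i - t * step_r G D p \<alpha> $ i"
    and "G *v z' + c + comb D (insert p \<alpha>) u' = 0"
    and "i \<in> \<alpha> \<Longrightarrow> slack D h i z' = 0"
    and "slack D h p z' = slack D h p z + t * (row p D \<bullet> step_d G D p \<alpha>)"
    and "slack D h p z' + u' $ p * (row p D \<bullet> step_d G D p \<alpha>) > 0"
    and "objective G c z' + u' $ p * slack D h p z'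
      = objective G c z + u $ p * slack D h p z - t * (slack D h p z + slack D h p z') / 2"
proof -
  have nd: "negdef_on D \<alpha>" and p: "p \<notin> \<alpha>" and u: "\<And>i. u $ i \<le> 0"
    and kkt: "G *v z + c + comb D (insert p \<alpha>) u = 0"
    and active: "\<And>i. i \<in> \<alpha> \<Longrightarrow> slack D h i z = 0"
    and pos: "slack D h p z + u $ p * (row p D \<bullet> step_d G D p \<alpha>) > 0"
    using inv by auto
  define d r where "d = step_d G D p \<alpha>" and "r = step_r G D p \<alpha>"
  have r0: "r $ i = 0" if "i \<notin> \<alpha>" for i
    using step_r_supported[OF nd, of p] that by (simp add: r_def supported_on_def)
  have z': "z' = z + t *\<^sub>R d" by (simp add: z'_def t d_def)
  have u': "u' = u - t *\<^sub>R (r + axis p 1)" by (simp add: u'_def t r_def)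
  have u'p: "u' $ p = u $ p - t" using r0[OF p] by (simp add: u' axis_def)
  have u'i: "u' $ i = u $ i - t * r $ i" if "i \<noteq> p" for i using that by (simp add: u' axis_def)
  show "u' $ i = u $ i - t * step_r G D p \<alpha> $ i" if "i \<in> \<alpha>" for i
    using u'i[of i] that p by (auto simp: r_def)
  show "u' $ i \<le> 0" for i
  proof (cases "i \<in> \<alpha>")
    case False
    then show ?thesis using u[of i] t(2) u'i[of i] r0[of i] u'p by (cases "i = p") auto
  next
    case True
    with p have "i \<noteq> p" by auto
    then have i: "u' $ i = u $ i - t * r $ i" by (rule u'i)
    show ?thesis
    proof (cases "r $ i < 0")
      case True
      \<comment> \<open>For a negative rate, \<open>t \<le> u $ i / r $ i\<close> says exactly that
        the multiplier does not become positive.\<close>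
      have "ereal t \<le> step_t1 G D p (z, \<alpha>, u)"
        by (simp add: t(1)[symmetric] step_t_def del: step_t1.simps step_t2.simps)
      also have "\<dots> \<le> ereal (u $ i / r $ i)"
        unfolding r_def by (rule step_t1_lower) (use \<open>i \<in> \<alpha>\<close> True in \<open>auto simp: r_def\<close>)
      finally have "t \<le> u $ i / r $ i" by simp
      then show ?thesis using True by (simp add: i neg_le_divide_eq)
    next
      case False
      then show ?thesis using u[of i] mult_nonneg_nonneg[OF t(2), of "r $ i"] by (simp add: i)
    qed
  qed
  have "comb D (insert p \<alpha>) (r + axis p 1) = row p D + comb D \<alpha> r"
  proof -
    have "comb D \<alpha> (r + axis p 1) = comb D \<alpha> r"
      unfolding comb_def by (rule sum.cong) (use p in \<open>auto simp: axis_def\<close>)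
    then show ?thesis using r0[OF p] by (simp add: comb_insert[OF p] axis_def)
  qed
  then have "comb D (insert p \<alpha>) (r + axis p 1) = G *v d"
    by (simp add: G_step_d[OF nd] d_def r_def)
  then have "G *v z' + c + comb D (insert p \<alpha>) u' = G *v z + c + comb D (insert p \<alpha>) u"
    by (simp add: z' u' matrix_vector_right_distrib matrix_vector_mult_scaleR comb_diff comb_scaleR)
  then show "G *v z' + c + comb D (insert p \<alpha>) u' = 0" using kkt by simp
  have d0: "row i D \<bullet> d = 0" if "i \<in> \<alpha>" for i unfolding d_def by (rule row_step_d[OF nd that])
  show "slack D h i z' = 0" if "i \<in> \<alpha>" for i
    using active[OF that] d0[OF that] by (simp add: z' slack_add)
  define k where "k = row p D \<bullet> d"
  show sp: "slack D h p z' = slack D h p z + t * (row p D \<bullet> step_d G D p \<alpha>)"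
    by (simp add: z' slack_add d_def)
  show "slack D h p z' + u' $ p * (row p D \<bullet> step_d G D p \<alpha>) > 0"
    using pos by (simp add: sp u'p algebra_simps)
  have "grad G c z \<bullet> d = - (u $ p * k)"
    using d0 p by (simp add: grad_inner[OF kkt] k_def)
  moreover have "d \<bullet> (G *v d) = k"
    unfolding k_def d_def by (rule step_d_quadratic[OF nd])
  ultimately have "objective G c z' = objective G c z - t * (u $ p * k) + t * t * k / 2"
    by (simp add: z' objective_add matrix_vector_mult_scaleR)
  then show "objective G c z' + u' $ p * slack D h p z'
      = objective G c z + u $ p * slack D h p z - t * (slack D h p z + slack D h p z') / 2"
    unfolding sp u'p d_def[symmetric] k_def[symmetric] by (simp add: field_simps)
qed

lemma full_step_S_pair:
  fixes D :: "real^('x + 'y)^'m::finite"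
  assumes inv: "step_invariant c D h p b (z, \<alpha>, u)"
    and full: "full_step G D h p (z, \<alpha>, u) (z', \<alpha>', u')"
  shows "S_pair G c D h z' (insert p \<alpha>)" "objective G c z' < b"
proof -
  from full have fin: "step_t G D h p (z, \<alpha>, u) \<noteq> \<infinity>"
    and t2: "step_t G D h p (z, \<alpha>, u) = step_t2 G D h p (z, \<alpha>, u)"
    and z': "z' = step_z G D h p (z, \<alpha>, u)" and u': "u' = step_u G D h p (z, \<alpha>, u)"
    by (auto simp del: step_z.simps step_u.simps step_t2.simps)
  obtain t where t: "step_t G D h p (z, \<alpha>, u) = ereal t" "t \<ge> 0"
    using step_t_nonneg[OF inv fin] by metis
  note facts = step_facts[OF inv t, folded z' u']
  define k where "k = row p D \<bullet> step_d G D p \<alpha>"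
  have k: "k < 0" and tk: "t = - slack D h p z / k"
    using fin t2 t(1) by (auto simp: k_def inner_commute split: if_splits)
  have s: "slack D h p z > 0" using inv by simp
  \<comment> \<open>The violated slack makes the step length positive, whence the strict decrease
    below.\<close>
  have t0: "t > 0" using k s by (simp add: tk divide_pos_neg)
  have sp: "slack D h p z' = 0" using k by (simp add: facts(5) k_def[symmetric] tk)
  show "S_pair G c D h z' (insert p \<alpha>)"
  proof (rule S_pairI)
    show "negdef_on D (insert p \<alpha>)"
      by (rule negdef_on_insert) (use inv k in \<open>auto simp: k_def\<close>)
  qed (use facts sp in auto)
  have "objective G c z' = objective G c z + u $ p * slack D h p z - t * slack D h p z / 2"
    using facts(7) by (simp add: sp)
  moreover have "t * slack D h p z > 0" using t0 s by simp
  ultimately show "objective G c z' < b" using inv by simp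
qed

lemma partial_step_invariant:
  fixes D :: "real^('x + 'y)^'m::finite"
  assumes inv: "step_invariant c D h p b (z, \<alpha>, u)"
    and partial: "partial_step G D h p pick (z, \<alpha>, u) (z', \<alpha>', u')"
    and pick: "tie_breaking G D p pick"
  shows "step_invariant c D h p b (z', \<alpha>', u')" "\<exists>k\<in>\<alpha>. \<alpha>' = \<alpha> - {k}"
proof -
  define k where "k = pick (z, \<alpha>, u)"
  define v where "v = step_u G D h p (z, \<alpha>, u)"
  from partial have fin: "step_t G D h p (z, \<alpha>, u) \<noteq> \<infinity>"
    and t2: "step_t G D h p (z, \<alpha>, u) \<noteq> step_t2 G D h p (z, \<alpha>, u)"
    and z': "z' = step_z G D h p (z, \<alpha>, u)" and \<alpha>': "\<alpha>' = \<alpha> - {k}"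
    and u': "u' = (\<chi> i. if i = k then 0 else v $ i)"
    by (auto simp: Let_def k_def v_def simp del: step_z.simps step_u.simps step_t2.simps)
  obtain t where t: "step_t G D h p (z, \<alpha>, u) = ereal t" "t \<ge> 0"
    using step_t_nonneg[OF inv fin] by metis
  note facts = step_facts[OF inv t, folded z' v_def]
  \<comment> \<open>A tie of the two step lengths counts as a full step, so a partial step lies
    strictly below \<open>step_t2\<close>.\<close>
  have t1: "step_t1 G D p (z, \<alpha>, u) = ereal t" and lt: "ereal t < step_t2 G D h p (z, \<alpha>, u)"
    using t2 t(1) by (auto simp: step_t_def min_def less_le split: if_splits
        simp del: step_t1.simps step_t2.simps)
  then have "k \<in> t1_attaining G D p (z, \<alpha>, u)"
    using pick t1_attaining_nonempty[of G D p z \<alpha> u] unfolding tie_breaking_def k_def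
    by (metis PInfty_neq_ereal(1))
  then have k: "k \<in> \<alpha>" "step_r G D p \<alpha> $ k < 0" "u $ k / step_r G D p \<alpha> $ k = t"
    using t1 by (auto simp del: step_t1.simps)
  then show "\<exists>k\<in>\<alpha>. \<alpha>' = \<alpha> - {k}" using \<alpha>' by blast
  have nd: "negdef_on D \<alpha>" and p: "p \<notin> \<alpha>" using inv by auto
  \<comment> \<open>The length \<open>t\<close> is the ratio at \<open>k\<close>, so the multiplier
    at \<open>k\<close> is already zero and deleting it changes nothing.\<close>
  have vk: "v $ k = 0" using facts(2)[OF k(1)] k(2,3) by (auto simp: field_simps)
  then have u'v: "u' = v" by (simp add: u' vec_eq_iff)
  have sub: "\<alpha>' \<subseteq> \<alpha>" using \<alpha>' by auto
  have "comb D (insert p \<alpha>) v = comb D (insert p \<alpha>') v"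
    by (rule comb_mono) (use vk \<alpha>' in auto)
  then have kkt: "G *v z' + c + comb D (insert p \<alpha>') v = 0" using facts(3) by simp
  have s: "slack D h p z > 0" using inv by simp
  define q where "q = row p D \<bullet> step_d G D p \<alpha>"
  have sp: "slack D h p z' > 0"
  proof (cases "q < 0")
    case True
    then have "t < - slack D h p z / q"
      using lt by (simp add: q_def inner_commute)
    from mult_strict_right_mono_neg[OF this True] have "t * q > - slack D h p z"
      using True by simp
    then show ?thesis by (simp add: facts(5) q_def[symmetric])
  next
    case False
    then have "t * q \<ge> 0" using t(2) by simp
    then show ?thesis using s by (simp add: facts(5) q_def[symmetric])
  qed
  \<comment> \<open>Dropping \<open>k\<close> does not increase the curvature; the nonpositive
    factor \<open>v $ p\<close> reverses the inequality.\<close>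
  have "v $ p * q \<le> v $ p * (row p D \<bullet> step_d G D p \<alpha>')"
    unfolding q_def by (rule mult_left_mono_neg[OF step_d_mono[OF nd sub] facts(1)])
  then have pos: "slack D h p z' + v $ p * (row p D \<bullet> step_d G D p \<alpha>') > 0"
    using facts(6) by (simp add: q_def)
  have "t * (slack D h p z + slack D h p z') \<ge> 0" using t(2) s sp by simp
  then have "objective G c z' + v $ p * slack D h p z' \<le> b"
    using facts(7) inv by simp
  then show "step_invariant c D h p b (z', \<alpha>', u')"
    using kkt sp pos facts(1,4) negdef_on_subset[OF nd sub] p sub by (auto simp: u'v)
qed

lemma stops_no_local_minimax:
  fixes D :: "real^('x + 'y)^'m::finite"
  assumes inv: "step_invariant c D h p b (z, \<alpha>, u)" and stop: "stops_at G D h p (z, \<alpha>, u)"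
  shows "\<not> local_minimax G c D h (insert p \<alpha>) w"
proof (rule no_local_minimax)
  have *: "step_t1 G D p (z, \<alpha>, u) = \<infinity>" "step_t2 G D h p (z, \<alpha>, u) = \<infinity>"
    using stop by (auto simp: stops_at_def step_t_def min_def split: if_splits
        simp del: step_t1.simps step_t2.simps)
  show "step_r G D p \<alpha> $ i \<ge> 0" if "i \<in> \<alpha>" for i
  proof (rule ccontr)
    assume "\<not> step_r G D p \<alpha> $ i \<ge> 0"
    then show False using step_t1_lower[OF that, of G D p z u] unfolding *(1) by simp
  qed
  show "row p D \<bullet> step_d G D p \<alpha> \<ge> 0"
    using *(2) by (auto simp: inner_commute split: if_splits)
qed (use inv in auto)

text \<open>Each partial step removes one index, so induction on \<open>card \<alpha>\<close>
  applies. The bound \<open>b\<close> stays fixed while the state varies, which keeps the final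
  decrease relative to the starting point.\<close>

lemma step_procedure:
  fixes D :: "real^('x + 'y)^'m::finite"
  assumes pick: "tie_breaking G D p pick" and inv: "step_invariant c D h p b (z, \<alpha>, u)"
  shows "(\<exists>z' \<alpha>' u' zbar ubar. \<alpha>' \<subseteq> \<alpha> \<and>
        (partial_step G D h p pick ^^ (card \<alpha> - card \<alpha>')) (z, \<alpha>, u) (z', \<alpha>', u') \<and>
        full_step G D h p (z', \<alpha>', u') (zbar, insert p \<alpha>', ubar) \<and>
        S_pair G c D h zbar (insert p \<alpha>') \<and> objective G c zbar < b)
     \<or> (\<exists>n z' \<alpha>' u'. n \<le> card \<alpha> \<and> \<alpha>' \<subseteq> \<alpha> \<and>
        (partial_step G D h p pick ^^ n) (z, \<alpha>, u) (z', \<alpha>', u') \<and>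
        stops_at G D h p (z', \<alpha>', u') \<and> \<not> (\<exists>w. local_minimax G c D h (insert p \<alpha>') w))"
  using inv
proof (induction "card \<alpha>" arbitrary: z \<alpha> u rule: less_induct)
  case less
  note inv = less.prems
  let ?T = "step_t G D h p (z, \<alpha>, u)"
  let ?R = "partial_step G D h p pick"
  consider "?T = \<infinity>" | "?T \<noteq> \<infinity>" "?T = step_t2 G D h p (z, \<alpha>, u)"
    | "?T \<noteq> \<infinity>" "?T \<noteq> step_t2 G D h p (z, \<alpha>, u)" by blast
  then show ?case
  proof cases
    case 1
    then have stop: "stops_at G D h p (z, \<alpha>, u)" by (simp add: stops_at_def)
    show ?thesis
      by (rule disjI2, intro exI[of _ 0] exI[of _ z] exI[of _ \<alpha>] exI[of _ u])
        (use stop stops_no_local_minimax[OF inv stop] in auto)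
  next
    case 2
    define zb ub where "zb = step_z G D h p (z, \<alpha>, u)" and "ub = step_u G D h p (z, \<alpha>, u)"
    have full: "full_step G D h p (z, \<alpha>, u) (zb, insert p \<alpha>, ub)"
      using 2 by (simp add: zb_def ub_def del: step_z.simps step_u.simps step_t2.simps)
    show ?thesis
      by (rule disjI1, intro exI[of _ z] exI[of _ \<alpha>] exI[of _ u] exI[of _ zb] exI[of _ ub])
        (use full full_step_S_pair[OF inv full] in auto)
  next
    case 3
    obtain z1 \<alpha>1 u1 where part: "?R (z, \<alpha>, u) (z1, \<alpha>1, u1)"
      using 3 by (auto simp: Let_def simp del: step_z.simps step_u.simps step_t2.simps)
    from partial_step_invariant(2)[OF inv part pick] obtain k where k: "k \<in> \<alpha>" "\<alpha>1 = \<alpha> - {k}" by blast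
    have card: "card \<alpha> = Suc (card \<alpha>1)"
      unfolding k(2) by (rule card.remove[OF finite k(1)])
    have sub: "\<alpha>1 \<subseteq> \<alpha>" using k by auto
    have "card \<alpha>1 < card \<alpha>" using card by simp
    from less.hyps[OF this partial_step_invariant(1)[OF inv part pick]]
    show ?thesis
    proof (elim disjE exE conjE)
      fix z' \<alpha>' u' zbar ubar
      assume *: "\<alpha>' \<subseteq> \<alpha>1" "(?R ^^ (card \<alpha>1 - card \<alpha>')) (z1, \<alpha>1, u1) (z', \<alpha>', u')"
        "full_step G D h p (z', \<alpha>', u') (zbar, insert p \<alpha>', ubar)"
        "S_pair G c D h zbar (insert p \<alpha>')" "objective G c zbar < b"
      \<comment> \<open>The step just made precedes those of the induction hypothesis, and
        \<open>\<alpha>1\<close> has one index fewer.\<close>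
      have "card \<alpha> - card \<alpha>' = Suc (card \<alpha>1 - card \<alpha>')"
        using card_mono[OF _ *(1)] by (simp add: card Suc_diff_le)
      then have "(?R ^^ (card \<alpha> - card \<alpha>')) (z, \<alpha>, u) (z', \<alpha>', u')"
        using relpowp_Suc_I2[OF part *(2)] by simp
      with * sub show ?thesis by blast
    next
      fix n z' \<alpha>' u'
      assume *: "n \<le> card \<alpha>1" "\<alpha>' \<subseteq> \<alpha>1" "(?R ^^ n) (z1, \<alpha>1, u1) (z', \<alpha>', u')"
        "stops_at G D h p (z', \<alpha>', u')" "\<not> (\<exists>w. local_minimax G c D h (insert p \<alpha>') w)"
      have "(?R ^^ Suc n) (z, \<alpha>, u) (z', \<alpha>', u')" by (rule relpowp_Suc_I2[OF part *(3)])
      moreover have "Suc n \<le> card \<alpha>" using *(1) card by simp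
      ultimately show ?thesis using *(2,4,5) sub by blast
    qed
  qed
qed

text \<open>At the start \<open>u $ p = 0\<close>, so the last two clauses reduce to violation of
  \<open>p\<close> and to equality with the bound.\<close>

lemma S_pair_step_invariant:
  fixes D :: "real^('x + 'y)^'m::finite"
  assumes S: "S_pair G c D h z \<alpha>" and p: "p \<notin> \<alpha>" and pos: "slack D h p z > 0"
  shows "step_invariant c D h p (objective G c z) (z, \<alpha>, multipliers G c D z \<alpha>)"
proof -
  from S obtain l where l: "\<forall>i\<in>\<alpha>. l i \<le> 0" "G *v z + c + (\<Sum>i\<in>\<alpha>. l i *\<^sub>R row i D) = 0"
    by (auto simp: S_pair_def)
  have nd: "negdef_on D \<alpha>"
    by (rule negdef_if_Gamma_posdef) (use S in \<open>auto simp: S_pair_def\<close>)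
  \<comment> \<open>\<open>l\<close> is arbitrary off \<alpha>; the cut-off vector is supported on
    \<alpha>, as \<open>multipliers_eq\<close> requires.\<close>
  define u :: "real^'m" where "u = (\<chi> i. if i \<in> \<alpha> then l i else 0)"
  have kkt: "G *v z + c + comb D \<alpha> u = 0" using l(2) by (simp add: comb_def u_def)
  have "multipliers G c D z \<alpha> = u"
    by (rule multipliers_eq[OF nd _ kkt]) (simp add: supported_on_def u_def)
  moreover have "u $ p = 0" using p by (simp add: u_def)
  moreover have "u $ i \<le> 0" for i using l(1) by (simp add: u_def)
  ultimately show ?thesis using S nd p pos kkt by (simp add: comb_insert S_pair_def)
qed

end

theorem theorem5:
  fixes G :: "real^('x::finite + 'y::finite)^('x + 'y)"
    and c :: "real^('x + 'y)"
    and D :: "real^('x + 'y)^'m::finite"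
    and h :: "real^'m"
    and z :: "real^('x + 'y)"
    and \<alpha> :: "'m set"
    and p :: 'm
    and pick :: "('x, 'y, 'm) state \<Rightarrow> 'm"
  assumes "transpose G = G"
    and "posdef (- blk22 G)"
    and "posdef (blk11 G - blk12 G ** matrix_inv (blk22 G) ** transpose (blk12 G))"
    and "S_pair G c D h z \<alpha>"
    and "p \<in> Kset G D - \<alpha>"
    and "row p D \<bullet> (Hmat G D \<alpha> *v row p D) \<ge> 0"
    and "slack D h p z > 0"
    and "tie_breaking G D p pick"
  shows
    "(\<exists>z' \<alpha>' u' zbar ubar.
        \<alpha>' \<subseteq> \<alpha> \<and>
        (partial_step G D h p pick ^^ (card \<alpha> - card \<alpha>'))
          (z, \<alpha>, multipliers G c D z \<alpha>) (z', \<alpha>', u') \<and>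
        full_step G D h p (z', \<alpha>', u') (zbar, insert p \<alpha>', ubar) \<and>
        S_pair G c D h zbar (insert p \<alpha>') \<and>
        objective G c zbar < objective G c z)
     \<or>
     (\<exists>n z' \<alpha>' u'.
        n \<le> card \<alpha> \<and>
        \<alpha>' \<subseteq> \<alpha> \<and>
        (partial_step G D h p pick ^^ n)
          (z, \<alpha>, multipliers G c D z \<alpha>) (z', \<alpha>', u') \<and>
        stops_at G D h p (z', \<alpha>', u') \<and>
        \<not> (\<exists>w. local_minimax G c D h (insert p \<alpha>') w))"
proof -
  interpret saddle_matrix G using assms(1-3) by unfold_locales
  show ?thesis
    by (rule step_procedure[OF assms(8) S_pair_step_invariant]) (use assms in auto)
qed

end
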